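(* Let $p$ be a fixed prime number and let $G=Z_p$ be the group of $p$-adic integers with Haar measure $m$. Take $n_k=k$ for all $k$. Then for any measurable function $f:G \to \mathbb{R}$, if $m(\Gamma_{f,b})>0$ then $f \in L^1(G)$.
   Context: $Z_p$ denotes the compact additive topological group of $p$-adic integers, and $m$ is its Haar measure, normalized so that $m(Z_p)=1$; measurability, "a.e." and $L^1(G)$ refer to $m$. For a measurable $f:G\to\mathbb{R}$ and with $n_k=k$, define $$\Gamma_{f,b}=\Big\{\alpha \in G: \limsup_{k \to \infty}\frac{|f(x+k \alpha)|}{k} < \infty \text{ for } m\text{-a.e. } x\in G\Big\},$$ where the limsup is over integers $k\ge 1$. *)

theory Defs
  imports "HOL-Probability.Probability" "HOL-Algebra.Ring" "HOL-Computational_Algebra.Primes"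
begin

text \<open>
  The ring of \<open>p\<close>-adic integers is the inverse limit of the rings of integers modulo \<open>p ^ n\<close>:
  an element is the sequence of its residues, each represented in \<open>{0..<p ^ n}\<close>. The topology is
  the subspace topology of the carrier in the product space \<^typ>\<open>nat \<Rightarrow> int\<close>, where
  \<^typ>\<open>int\<close> carries its usual (discrete) topology.
\<close>

definition padic_int :: "nat \<Rightarrow> (nat \<Rightarrow> int) ring" where
  "padic_int p =
    \<lparr>carrier = {x. \<forall>n. x n \<in> {0..<int p ^ n} \<and> x (Suc n) mod int p ^ n = x n},
     mult = (\<lambda>x y n. (x n * y n) mod int p ^ n),
     one = (\<lambda>n. 1 mod int p ^ n),
     zero = (\<lambda>n. 0),
     add = (\<lambda>x y n. (x n + y n) mod int p ^ n)\<rparr>"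

text \<open>
  On a compact metrizable group every finite Borel measure is regular, so no regularity
  condition is needed to characterize normalized Haar measure.
\<close>

definition padic_haar_measure :: "nat \<Rightarrow> (nat \<Rightarrow> int) measure \<Rightarrow> bool" where
  "padic_haar_measure p M \<longleftrightarrow>
     sets M = sets (restrict_space borel (carrier (padic_int p))) \<and>
     emeasure M (carrier (padic_int p)) = 1 \<and>
     (\<forall>a \<in> carrier (padic_int p). \<forall>A \<in> sets M.
        emeasure M ((\<lambda>x. a \<oplus>\<^bsub>padic_int p\<^esub> x) ` A) = emeasure M A)"

definition Gamma_b :: "nat \<Rightarrow> (nat \<Rightarrow> int) measure \<Rightarrow> ((nat \<Rightarrow> int) \<Rightarrow> real) \<Rightarrow> (nat \<Rightarrow> int) set" where
  "Gamma_b p M f =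
     {\<alpha> \<in> carrier (padic_int p).
        AE x in M. limsup (\<lambda>k::nat. ereal
          (\<bar>f (x \<oplus>\<^bsub>padic_int p\<^esub> [k] \<cdot>\<^bsub>padic_int p\<^esub> \<alpha>)\<bar> / real k)) < \<infinity>}"

text \<open>The rest of this theory checks that the definitions describe a compact topological
  group and that a Haar measure exists.\<close>

lemma padic_carrier:
  "x \<in> carrier (padic_int p) \<longleftrightarrow> (\<forall>n. x n \<in> {0..<int p ^ n} \<and> x (Suc n) mod int p ^ n = x n)"
  by (simp add: padic_int_def)

lemma padic_add: "(x \<oplus>\<^bsub>padic_int p\<^esub> y) n = (x n + y n) mod int p ^ n"
  by (simp add: padic_int_def)

lemma padic_mod_Suc:
  fixes p :: nat and a :: int
  shows "(a mod int p ^ Suc n) mod int p ^ n = a mod int p ^ n"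
  by (simp add: mod_mod_cancel)

lemma padic_int_cring:
  assumes "p > 0"
  shows "cring (padic_int p)"
proof -
  have pos: "int p ^ n > 0" for n using assms by simp
  have closed: "(\<lambda>n. h n mod int p ^ n) \<in> carrier (padic_int p)"
    if "\<And>n. h (Suc n) mod int p ^ n = h n mod int p ^ n" for h :: "nat \<Rightarrow> int"
    unfolding padic_carrier using pos that by (simp add: padic_mod_Suc del: power_Suc)
  have small: "x n mod int p ^ n = x n" if "x \<in> carrier (padic_int p)" for x n
    using that by (simp add: padic_carrier)
  have step: "x (Suc n) mod int p ^ n = x n" if "x \<in> carrier (padic_int p)" for x n
    using that by (simp add: padic_carrier)
  have uminus: "\<exists>y \<in> carrier (padic_int p). (\<lambda>n. (y n + x n) mod int p ^ n) = (\<lambda>n. 0)"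
    if x: "x \<in> carrier (padic_int p)" for x
  proof
    show "(\<lambda>n. (- x n) mod int p ^ n) \<in> carrier (padic_int p)"
      by (rule closed) (metis mod_minus_eq step[OF x] small[OF x])
  qed (simp add: mod_simps)
  show ?thesis
  proof (rule cringI)
    show "abelian_group (padic_int p)"
    proof (rule abelian_groupI)
      fix x y assume "x \<in> carrier (padic_int p)" "y \<in> carrier (padic_int p)"
      then show "x \<oplus>\<^bsub>padic_int p\<^esub> y \<in> carrier (padic_int p)"
        by (subst padic_int_def, simp, intro closed) (metis mod_add_eq step small)
    next
      fix x assume "x \<in> carrier (padic_int p)"
      then show "\<exists>y \<in> carrier (padic_int p). y \<oplus>\<^bsub>padic_int p\<^esub> x = \<zero>\<^bsub>padic_int p\<^esub>"
        using uminus[of x] by (simp add: padic_int_def)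
    qed (use pos small in \<open>auto simp: padic_int_def mod_simps add_ac\<close>)
    show "Group.comm_monoid (padic_int p)"
    proof (rule comm_monoidI)
      fix x y assume "x \<in> carrier (padic_int p)" "y \<in> carrier (padic_int p)"
      then show "x \<otimes>\<^bsub>padic_int p\<^esub> y \<in> carrier (padic_int p)"
        by (subst padic_int_def, simp, intro closed) (metis mod_mult_eq step small)
    next
      show "\<one>\<^bsub>padic_int p\<^esub> \<in> carrier (padic_int p)"
        by (subst padic_int_def, simp, rule closed) simp
    qed (use small in \<open>auto simp: padic_int_def mod_simps mult_ac\<close>)
  qed (auto simp: padic_int_def mod_simps algebra_simps)
qed

lemma continuous_on_discrete_fun2:
  fixes g :: "int \<Rightarrow> int \<Rightarrow> 'b::topological_space" and u v :: "'a::topological_space \<Rightarrow> int"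
  assumes "continuous_on S u" "continuous_on S v"
  shows "continuous_on S (\<lambda>z. g (u z) (v z))"
proof -
  have "open {z}" for z :: "int \<times> int"
    using open_Times[of "{fst z}" "{snd z}"] by (cases z) (simp add: Topological_Spaces.open_discrete)
  then have op: "open S" for S :: "(int \<times> int) set"
    by (metis UN_singleton open_UN)
  have "continuous_on UNIV (\<lambda>(a, b). g a b)"
    by (subst continuous_on_open_vimage) (simp_all add: op)
  from continuous_on_compose2[OF this continuous_on_Pair[OF assms]] show ?thesis
    by simp
qed

lemma padic_closed: "closed (carrier (padic_int p))"
proof -
  have c: "continuous_on UNIV (\<lambda>x::nat \<Rightarrow> int. x n)" for n by simp
  have *: "closed {x::nat \<Rightarrow> int. P (x m) (x n)}" for P :: "int \<Rightarrow> int \<Rightarrow> bool" and m n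
  proof -
    have "closed {x::nat \<Rightarrow> int. (if P (x m) (x n) then 1 else 0 :: int) = 1}"
      by (rule closed_Collect_eq[OF continuous_on_discrete_fun2[OF c c, of "\<lambda>a b. if P a b then 1 else 0"]
            continuous_on_const])
    then show ?thesis by (simp cong: conj_cong split: if_splits)
  qed
  have "closed {x::nat \<Rightarrow> int. x n \<in> {0..<int p ^ n} \<and> x (Suc n) mod int p ^ n = x n}" for n
    by (rule *[of "\<lambda>a b. b \<in> {0..<int p ^ n} \<and> a mod int p ^ n = b"])
  moreover have "carrier (padic_int p) =
      (\<Inter>n. {x. x n \<in> {0..<int p ^ n} \<and> x (Suc n) mod int p ^ n = x n})"
    by (auto simp: padic_carrier)
  ultimately show ?thesis by (metis (lifting) closed_INT)
qed

lemma padic_compact: "compact (carrier (padic_int p))"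
proof -
  have "compactin (product_topology (\<lambda>n. euclidean) UNIV)
      (\<Pi>\<^sub>E n\<in>UNIV. {0..<int p ^ n})"
    by (subst compactin_PiE) (simp add: finite_imp_compact)
  then have "compact (\<Pi>\<^sub>E n\<in>UNIV. {0..<int p ^ n})"
    by (simp add: euclidean_product_topology)
  moreover have "carrier (padic_int p) \<subseteq> (\<Pi>\<^sub>E n\<in>UNIV. {0..<int p ^ n})"
    by (auto simp: padic_carrier PiE_iff)
  ultimately show ?thesis
    using padic_closed by (metis compact_Int_closed inf.absorb_iff2)
qed

lemma padic_continuous_add:
  "continuous_on UNIV (\<lambda>z. fst z \<oplus>\<^bsub>padic_int p\<^esub> snd z)"
proof -
  have "continuous_on UNIV (\<lambda>z::(nat \<Rightarrow> int) \<times> (nat \<Rightarrow> int). (fst z n + snd z n) mod int p ^ n)" for n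
    by (rule continuous_on_discrete_fun2[where g = "\<lambda>a b. (a + b) mod int p ^ n"];
        rule continuous_on_product_then_coordinatewise; intro continuous_intros)
  then have "continuous_on UNIV (\<lambda>z. (fst z \<oplus>\<^bsub>padic_int p\<^esub> snd z) n)" for n
    unfolding padic_add .
  then show ?thesis
    by (rule continuous_on_coordinatewise_then_product)
qed

lemma padic_level_mod:
  assumes "x \<in> carrier (padic_int p)" "n \<le> m"
  shows "x n = x m mod int p ^ n"
  using assms(2)
proof (induction m rule: dec_induct)
  case base
  then show ?case using assms(1) by (simp add: padic_carrier)
next
  case (step m)
  have "x (Suc m) mod int p ^ n = x (Suc m) mod int p ^ m mod int p ^ n"
    using step by (simp add: mod_mod_cancel le_imp_power_dvd)
  then show ?case using assms(1) step by (simp add: padic_carrier)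
qed

definition padic_cylinder :: "nat \<Rightarrow> nat \<Rightarrow> int \<Rightarrow> (nat \<Rightarrow> int) set" where
  "padic_cylinder p n c = {x \<in> carrier (padic_int p). x n = c}"

lemma padic_cylinder_empty: "c \<notin> {0..<int p ^ n} \<Longrightarrow> padic_cylinder p n c = {}"
  by (auto simp: padic_cylinder_def padic_carrier)

lemma Int_stable_padic_cylinder: "Int_stable (range (case_prod (padic_cylinder p)))"
proof -
  have *: "padic_cylinder p n c \<inter> padic_cylinder p m d \<in> range (case_prod (padic_cylinder p))"
    if "n \<le> m" for n m c d
  proof (cases "c = d mod int p ^ n")
    case True
    then have "padic_cylinder p n c \<inter> padic_cylinder p m d = padic_cylinder p m d"
      using padic_level_mod[OF _ that] by (auto simp: padic_cylinder_def)
    then show ?thesis by (auto intro: range_eqI[of _ _ "(m, d)"])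
  next
    case False
    then have "padic_cylinder p n c \<inter> padic_cylinder p m d = {}"
      using padic_level_mod[OF _ that] by (auto simp: padic_cylinder_def)
    also have "\<dots> = padic_cylinder p 0 1"
      by (rule padic_cylinder_empty[symmetric]) simp
    finally have "padic_cylinder p n c \<inter> padic_cylinder p m d = padic_cylinder p 0 1" .
    then show ?thesis by (auto intro: range_eqI[of _ _ "(0, 1)"])
  qed
  show ?thesis
    by (rule Int_stableI) (use * in \<open>auto; metis Int_commute nle_le\<close>)
qed

lemma padic_coord_measurable:
  "(\<lambda>x. x n) \<in> restrict_space borel S \<rightarrow>\<^sub>M (borel :: int measure)"
  by (rule measurable_restrict_space1) (simp add: borel_measurable_continuous_onI)

lemma measurable_discrete_int: "(g :: int \<Rightarrow> 'a::topological_space) \<in> borel_measurable borel"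
  by (intro borel_measurable_continuous_onI Topological_Spaces.continuous_on_discrete)

instance int :: second_countable_topology
proof
  show "\<exists>B::int set set. countable B \<and> open = generate_topology B"
    by (intro exI[of _ "range lessThan \<union> range greaterThan"]) (auto simp: open_int_def)
qed

lemma measurable_into_padic:
  fixes h :: "'a \<Rightarrow> nat \<Rightarrow> int"
  assumes "\<And>n. (\<lambda>z. h z n) \<in> N \<rightarrow>\<^sub>M (borel :: int measure)"
    and "\<And>z. z \<in> space N \<Longrightarrow> h z \<in> S"
  shows "h \<in> N \<rightarrow>\<^sub>M restrict_space borel S"
proof (rule measurable_restrict_space2)
  show "h \<in> borel_measurable N"
    by (rule measurable_coordinatewise_then_product) (rule assms(1))
qed (use assms(2) in auto)

lemma sets_borel_padic:
  "sets (restrict_space borel (carrier (padic_int p))) =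
     sigma_sets (carrier (padic_int p)) (range (case_prod (padic_cylinder p)))"
proof
  let ?Z = "carrier (padic_int p)"
  let ?S = "sigma ?Z (range (case_prod (padic_cylinder p)))"
  have sub: "range (case_prod (padic_cylinder p)) \<subseteq> Pow ?Z"
    by (auto simp: padic_cylinder_def)
  have "(\<lambda>x. x n) \<in> ?S \<rightarrow>\<^sub>M (count_space UNIV :: int measure)" for n
  proof (subst measurable_count_space_eq2_countable, safe)
    fix c
    have "(\<lambda>x. x n) -` {c} \<inter> space ?S = padic_cylinder p n c"
      using sub by (auto simp: padic_cylinder_def)
    also have "\<dots> \<in> sets ?S"
      using sub by (auto intro: sigma_sets.Basic)
    finally show "(\<lambda>x. x n) -` {c} \<inter> space ?S \<in> sets ?S" .
  qed auto
  then have "(\<lambda>x. x n) \<in> ?S \<rightarrow>\<^sub>M (borel :: int measure)" for n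
    by (rule measurable_compose) simp
  then have "(\<lambda>x. x) \<in> ?S \<rightarrow>\<^sub>M restrict_space borel ?Z"
    by (rule measurable_into_padic) (use sub in auto)
  from measurable_sets[OF this]
  have "A \<in> sets ?S" if "A \<in> sets (restrict_space borel ?Z)" for A
  proof -
    have "A \<subseteq> ?Z" using that by (auto simp: sets_restrict_space)
    then have "(\<lambda>x. x) -` A \<inter> space ?S = A" using sub by auto
    with \<open>\<And>A. A \<in> sets (restrict_space borel ?Z) \<Longrightarrow> (\<lambda>x. x) -` A \<inter> space ?S \<in> sets ?S\<close>[OF that]
    show ?thesis by simp
  qed
  then show "sets (restrict_space borel ?Z) \<subseteq> sigma_sets ?Z (range (case_prod (padic_cylinder p)))"
    using sub by auto
  have "padic_cylinder p n c \<in> sets (restrict_space borel ?Z)" for n c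
  proof -
    have "(\<lambda>x. x n) -` {c} \<inter> space (restrict_space borel ?Z) \<in> sets (restrict_space borel ?Z)"
      by (rule measurable_sets[OF padic_coord_measurable]) simp
    also have "(\<lambda>x. x n) -` {c} \<inter> space (restrict_space borel ?Z) = padic_cylinder p n c"
      by (auto simp: padic_cylinder_def space_restrict_space)
    finally show ?thesis .
  qed
  then have "range (case_prod (padic_cylinder p)) \<subseteq> sets (restrict_space borel ?Z)"
    by auto
  from sets.sigma_sets_subset[OF this]
  show "sigma_sets ?Z (range (case_prod (padic_cylinder p))) \<subseteq> sets (restrict_space borel ?Z)"
    by (simp add: space_restrict_space)
qed

lemma padic_digit_sum_bounds:
  assumes "\<And>i. d i \<in> {0..<int p}"
  shows "(\<Sum>i<n. d i * int p ^ i) \<in> {0..<int p ^ n}"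
proof (induction n)
  case (Suc n)
  have "d n * int p ^ n \<le> (int p - 1) * int p ^ n" "0 \<le> d n * int p ^ n"
    using assms[of n] by (auto intro!: mult_right_mono)
  with Suc show ?case by (auto simp: algebra_simps)
qed auto

lemma padic_digits:
  assumes "p > 0" "c \<in> {0..<int p ^ n}"
  shows "\<exists>e. (\<forall>i. e i \<in> {0..<int p}) \<and>
    (\<forall>d. (\<forall>i. d i \<in> {0..<int p}) \<longrightarrow> ((\<Sum>i<n. d i * int p ^ i) = c \<longleftrightarrow> (\<forall>i<n. d i = e i)))"
  using assms(2)
proof (induction n arbitrary: c)
  case 0
  then show ?case using assms(1) by (intro exI[of _ "\<lambda>_. 0"]) auto
next
  case (Suc n)
  have pos: "int p ^ n > 0" using assms(1) by simp
  obtain e where e: "\<And>i. e i \<in> {0..<int p}"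
    "\<And>d. (\<forall>i. d i \<in> {0..<int p}) \<Longrightarrow>
       (\<Sum>i<n. d i * int p ^ i) = c mod int p ^ n \<longleftrightarrow> (\<forall>i<n. d i = e i)"
    using Suc.IH[of "c mod int p ^ n"] pos by auto
  have "c < int p * int p ^ n"
    using Suc.prems by simp
  then have "c div int p ^ n * int p ^ n < int p * int p ^ n"
    using div_mult_mod_eq[of c "int p ^ n"] pos_mod_sign[OF pos, of c] by linarith
  then have "c div int p ^ n < int p"
    using pos by simp
  moreover have "c div int p ^ n \<ge> 0"
    using Suc.prems pos by (simp add: pos_imp_zdiv_nonneg_iff)
  moreover have "(\<Sum>i<Suc n. d i * int p ^ i) = c \<longleftrightarrow> (\<forall>i<Suc n. d i = (e(n := c div int p ^ n)) i)"
    if d: "\<forall>i. d i \<in> {0..<int p}" for d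
  proof -
    have b: "(\<Sum>i<n. d i * int p ^ i) \<in> {0..<int p ^ n}"
      using d by (intro padic_digit_sum_bounds) auto
    have "(\<Sum>i<Suc n. d i * int p ^ i) = c \<longleftrightarrow>
        (\<Sum>i<n. d i * int p ^ i) = c mod int p ^ n \<and> d n = c div int p ^ n"
    proof
      assume "(\<Sum>i<Suc n. d i * int p ^ i) = c"
      then have "c = (\<Sum>i<n. d i * int p ^ i) + d n * int p ^ n" by simp
      then show "(\<Sum>i<n. d i * int p ^ i) = c mod int p ^ n \<and> d n = c div int p ^ n"
        using b pos by simp
    qed (simp add: mod_div_mult_eq)
    then show ?thesis using e(2)[OF d] by (auto simp: less_Suc_eq)
  qed
  ultimately show ?case
    using e(1) by (intro exI[of _ "e(n := c div int p ^ n)"]) auto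
qed

lemma padic_haar_measure_exists:
  assumes p: "p > 0"
  shows "\<exists>M. padic_haar_measure p M"
proof -
  let ?Z = "carrier (padic_int p)"
  let ?B = "restrict_space borel ?Z"
  define U where "U = uniform_count_measure {0..<int p}"
  interpret U: prob_space U
    unfolding U_def using p by (intro prob_space_uniform_count_measure) auto
  interpret D: product_prob_space "\<lambda>_::nat. U" UNIV
    by standard
  let ?D = "Pi\<^sub>M (UNIV :: nat set) (\<lambda>_. U)"
  define \<phi> :: "(nat \<Rightarrow> int) \<Rightarrow> nat \<Rightarrow> int" where "\<phi> d n = (\<Sum>i<n. d i * int p ^ i)" for d n
  have dig: "d i \<in> {0..<int p}" if "d \<in> space ?D" for d i
    using that by (auto simp: space_PiM U_def space_uniform_count_measure PiE_iff)
  have \<phi>_Z: "\<phi> d \<in> ?Z" if "d \<in> space ?D" for d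
    using padic_digit_sum_bounds[of d p, OF dig[OF that]] p
    by (auto simp: padic_carrier \<phi>_def)
  have d_cs: "(\<lambda>d. d i) \<in> ?D \<rightarrow>\<^sub>M count_space UNIV" for i
  proof (rule measurable_compose[OF measurable_component_singleton])
    show "(\<lambda>x. x) \<in> U \<rightarrow>\<^sub>M count_space UNIV"
      by (auto simp: measurable_def U_def space_uniform_count_measure sets_uniform_count_measure)
  qed simp
  have \<phi>_cs: "(\<lambda>d. \<phi> d n) \<in> ?D \<rightarrow>\<^sub>M count_space UNIV" for n
  proof (induction n)
    case (Suc n)
    have "(\<lambda>d. a + d n * int p ^ n) \<in> ?D \<rightarrow>\<^sub>M count_space UNIV" for a
      by (rule measurable_compose[OF d_cs]) simp
    from measurable_compose_countable[OF this Suc] show ?case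
      by (simp add: \<phi>_def)
  qed (simp add: \<phi>_def)
  have \<phi>_meas: "\<phi> \<in> ?D \<rightarrow>\<^sub>M ?B"
    by (intro measurable_into_padic \<phi>_Z measurable_compose[OF \<phi>_cs]) simp
  define M where "M = distr ?D ?B \<phi>"
  have sets_M: "sets M = sets ?B" and space_M: "space M = ?Z"
    by (simp_all add: M_def space_restrict_space)
  interpret M: prob_space M
    unfolding M_def by (rule D.prob_space_distr[OF \<phi>_meas])
  have cyl_sets: "padic_cylinder p n c \<in> sets M" for n c
    unfolding sets_M sets_borel_padic by (auto intro: sigma_sets.Basic)
  have cyl: "emeasure M (padic_cylinder p n c) = (\<Prod>i<n. ennreal (1 / p))"
    if c: "c \<in> {0..<int p ^ n}" for n c
  proof -
    obtain e where e: "\<And>i. e i \<in> {0..<int p}"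
      "\<And>d. (\<forall>i. d i \<in> {0..<int p}) \<Longrightarrow> \<phi> d n = c \<longleftrightarrow> (\<forall>i<n. d i = e i)"
      using padic_digits[OF p c] unfolding \<phi>_def by blast
    have "emeasure M (padic_cylinder p n c) = emeasure ?D (\<phi> -` padic_cylinder p n c \<inter> space ?D)"
      unfolding M_def using \<phi>_meas cyl_sets sets_M by (subst emeasure_distr) auto
    also have "\<phi> -` padic_cylinder p n c \<inter> space ?D = {d \<in> space ?D. \<forall>i\<in>{..<n}. d i \<in> {e i}}"
      using e(2) dig \<phi>_Z by (auto simp: padic_cylinder_def)
    also have "emeasure ?D \<dots> = (\<Prod>i<n. emeasure U {e i})"
      using e(1) by (intro D.emeasure_PiM_Collect) (auto simp: U_def sets_uniform_count_measure)
    also have "\<dots> = (\<Prod>i<n. ennreal (1 / p))"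
      using e(1) by (intro prod.cong) (auto simp: U_def emeasure_uniform_count_measure)
    finally show ?thesis .
  qed
  interpret Z: cring "padic_int p" by (rule padic_int_cring[OF p])
  have tr_meas: "(\<lambda>x. b \<oplus>\<^bsub>padic_int p\<^esub> x) \<in> M \<rightarrow>\<^sub>M M" if b: "b \<in> ?Z" for b
  proof -
    have "(\<lambda>x. (b n + x n) mod int p ^ n) \<in> ?B \<rightarrow>\<^sub>M borel" for n
      by (rule measurable_compose[OF padic_coord_measurable measurable_discrete_int])
    then have "(\<lambda>x. b \<oplus>\<^bsub>padic_int p\<^esub> x) \<in> ?B \<rightarrow>\<^sub>M ?B"
      using b by (intro measurable_into_padic) (simp_all add: padic_add space_restrict_space)
    then show ?thesis
      using measurable_cong_sets[OF sets_M sets_M] by blast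
  qed
  have inv: "distr M M (\<lambda>x. b \<oplus>\<^bsub>padic_int p\<^esub> x) = M" if b: "b \<in> ?Z" for b
  proof (rule measure_eqI_generator_eq[OF Int_stable_padic_cylinder])
    show "range (case_prod (padic_cylinder p)) \<subseteq> Pow ?Z"
      by (auto simp: padic_cylinder_def)
    show "sets (distr M M (\<lambda>x. b \<oplus>\<^bsub>padic_int p\<^esub> x)) =
        sigma_sets ?Z (range (case_prod (padic_cylinder p)))"
      "sets M = sigma_sets ?Z (range (case_prod (padic_cylinder p)))"
      by (simp_all add: sets_M sets_borel_padic)
    show "range (\<lambda>i::nat. padic_cylinder p 0 0) \<subseteq> range (case_prod (padic_cylinder p))"
      by auto
    show "(\<Union>i::nat. padic_cylinder p 0 0) = ?Z"
    proof -
      have "x 0 = 0" if "x \<in> ?Z" for x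
        using that[unfolded padic_carrier, rule_format, of 0] by simp
      then show ?thesis by (auto simp: padic_cylinder_def)
    qed
    show "emeasure (distr M M (\<lambda>x. b \<oplus>\<^bsub>padic_int p\<^esub> x)) (padic_cylinder p 0 0) \<noteq> \<infinity>" for i :: nat
      using tr_meas[OF b] cyl_sets by (simp add: emeasure_distr)
    fix X assume "X \<in> range (case_prod (padic_cylinder p))"
    then obtain n c where X: "X = padic_cylinder p n c" by auto
    show "emeasure (distr M M (\<lambda>x. b \<oplus>\<^bsub>padic_int p\<^esub> x)) X = emeasure M X"
    proof (cases "c \<in> {0..<int p ^ n}")
      case False
      then show ?thesis by (simp add: X padic_cylinder_empty)
    next
      case True
      define c' where "c' = (c - b n) mod int p ^ n"
      have c': "c' \<in> {0..<int p ^ n}" using p by (simp add: c'_def)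
      have iff: "(b n + y) mod int p ^ n = c \<longleftrightarrow> y = c'" if "y \<in> {0..<int p ^ n}" for y
      proof
        assume "(b n + y) mod int p ^ n = c"
        then have "c' = (b n + y - b n) mod int p ^ n" unfolding c'_def by (metis mod_diff_left_eq)
        then show "y = c'" using that by simp
      next
        assume "y = c'"
        then have "(b n + y) mod int p ^ n = c mod int p ^ n" by (simp add: c'_def mod_simps)
        then show "(b n + y) mod int p ^ n = c" using True by simp
      qed
      have "(\<lambda>x. b \<oplus>\<^bsub>padic_int p\<^esub> x) -` X \<inter> space M = padic_cylinder p n c'"
        using b iff Z.add.m_closed
        by (auto simp: X padic_cylinder_def space_M padic_add) (auto simp: padic_carrier)
      then show ?thesis
        using tr_meas[OF b] cyl_sets cyl[OF True] cyl[OF c'] by (simp add: emeasure_distr X)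
    qed
  qed
  have "emeasure M ((\<lambda>x. a \<oplus>\<^bsub>padic_int p\<^esub> x) ` A) = emeasure M A" if a: "a \<in> ?Z" and A: "A \<in> sets M" for a A
  proof -
    let ?b = "\<ominus>\<^bsub>padic_int p\<^esub> a"
    have AZ: "A \<subseteq> ?Z" using A sets.sets_into_space space_M by auto
    have "(\<lambda>x. ?b \<oplus>\<^bsub>padic_int p\<^esub> x) -` A \<inter> space M = (\<lambda>x. a \<oplus>\<^bsub>padic_int p\<^esub> x) ` A"
    proof (intro equalityI subsetI)
      fix x assume "x \<in> (\<lambda>x. ?b \<oplus>\<^bsub>padic_int p\<^esub> x) -` A \<inter> space M"
      then show "x \<in> (\<lambda>x. a \<oplus>\<^bsub>padic_int p\<^esub> x) ` A"
        using a by (intro image_eqI[of _ _ "?b \<oplus>\<^bsub>padic_int p\<^esub> x"]) (auto simp: space_M Z.r_neg2)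
    qed (use a AZ in \<open>auto simp: space_M Z.r_neg1 subset_iff\<close>)
    then show ?thesis
      using inv[of ?b] tr_meas[of ?b] a A emeasure_distr[of "\<lambda>x. ?b \<oplus>\<^bsub>padic_int p\<^esub> x" M M A] by simp
  qed
  then have "padic_haar_measure p M"
    unfolding padic_haar_measure_def using sets_M M.emeasure_space_1 space_M by auto
  then show ?thesis ..
qed

end

theory Submission
  imports Defs "HOL-Number_Theory.Cong"
begin

text \<open>
  Let \<open>V r\<close> be the set of \<open>\<alpha>\<close> of valuation exactly \<open>r\<close>. If \<open>f\<close> is not integrable, it is not integrable
  on some coset \<open>K\<close> of \<open>p ^ r Z\<^sub>p\<close>, so the sets \<open>F j = {x \<in> K. \<bar>f x\<bar> > 2 C p ^ j}\<close> satisfy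
  \<open>\<Sum>\<^sub>j p ^ j m (F j) = \<infinity>\<close> for every \<open>C > 0\<close>. Pick \<open>(\<alpha>, x)\<close> uniformly in \<open>V r \<times> K\<close> and let \<open>X j\<close> count the
  \<open>k \<in> [p ^ j, 2 p ^ j)\<close> with \<open>x + k \<alpha> \<in> F j\<close>; its mean is \<open>\<mu> j = p ^ (j + r) m (F j)\<close>.
  Multiplication by an integer of valuation \<open>v\<close> maps \<open>m\<close> to \<open>p ^ v\<close> times the restriction of \<open>m\<close> to \<open>p ^ v Z\<^sub>p\<close>.
  Given \<open>k\<close>, there are \<open>p ^ (j - v) (1 - 1 / p)\<close> indices \<open>l\<close> in the \<open>j\<close>-th block with \<open>l - k\<close> of valuation
  \<open>v < j\<close>, and these two factors cancel. Since \<open>\<alpha>\<close> has a fixed valuation, distinct \<open>v\<close> contribute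
  disjoint sets of pairs \<open>(x + k \<alpha>, x + l \<alpha>)\<close>. This gives
  \<open>E (X i X j) \<le> \<mu> i \<mu> j + p ^ (i - j) \<mu> j\<close> for \<open>i \<le> j\<close>, and Chebyshev's inequality shows that
  \<open>\<Sum>\<^sub>j X j = \<infinity>\<close> almost surely. Hence \<open>\<bar>f (x + k \<alpha>)\<bar> > C k\<close> infinitely often for almost all
  \<open>\<alpha> \<in> V r\<close> and \<open>x \<in> K\<close>; as the sets \<open>V r\<close> cover almost everything, \<open>\<Gamma>\<close> is a null set.
\<close>

section \<open>Almost sure divergence from a second-moment bound\<close>

text \<open>Chebyshev's inequality: \<open>second\<close> bounds the variance of the partial sums by
  \<open>C\<close> times their mean, which is negligible against the squared mean as the means tend
  to infinity. Hence the partial sums stay below a fixed bound with probability 0.\<close>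

lemma (in prob_space) AE_not_summable_second_moment:
  fixes X :: "nat \<Rightarrow> 'a \<Rightarrow> real" and \<mu> :: "nat \<Rightarrow> real"
  assumes int1: "\<And>i. integrable M (X i)"
    and int2: "\<And>i j. integrable M (\<lambda>z. X i z * X j z)"
    and nonneg: "\<And>i z. X i z \<ge> 0"
    and mean: "\<And>i. expectation (X i) = \<mu> i"
    and second: "\<And>n. (\<Sum>i<n. \<Sum>j<n. expectation (\<lambda>z. X i z * X j z)) \<le> (\<Sum>i<n. \<mu> i)\<^sup>2 + C * (\<Sum>i<n. \<mu> i)"
    and C: "C \<ge> 0"
    and div: "\<not> summable \<mu>"
  shows "AE z in M. \<not> summable (\<lambda>i. X i z)"
proof -
  define S where "S n z = (\<Sum>i<n. X i z)" for n z
  define s where "s n = (\<Sum>i<n. \<mu> i)" for n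
  have [measurable]: "X i \<in> borel_measurable M" for i
    using int1 by auto
  have [measurable]: "S n \<in> borel_measurable M" for n
    unfolding S_def by measurable
  have intS: "integrable M (S n)" for n
    unfolding S_def by (intro Bochner_Integration.integrable_sum int1)
  have sq: "(S n z)\<^sup>2 = (\<Sum>i<n. \<Sum>j<n. X i z * X j z)" for n z
    by (simp add: S_def power2_eq_square sum_product)
  have intS2: "integrable M (\<lambda>z. (S n z)\<^sup>2)" for n
    unfolding sq by (intro Bochner_Integration.integrable_sum int2)
  have ES: "expectation (S n) = s n" for n
    unfolding S_def s_def using int1 mean by (subst Bochner_Integration.integral_sum) auto
  have var: "variance (S n) \<le> C * s n" for n
  proof -
    have "expectation (\<lambda>z. (S n z)\<^sup>2) = (\<Sum>i<n. \<Sum>j<n. expectation (\<lambda>z. X i z * X j z))"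
      unfolding sq by (simp add: Bochner_Integration.integral_sum int2)
    with second[of n] show ?thesis
      by (subst variance_eq[OF intS intS2]) (simp add: ES s_def)
  qed
  have \<mu>: "\<mu> i \<ge> 0" for i
    unfolding mean[symmetric] by (rule Bochner_Integration.integral_nonneg) (rule nonneg)
  have unb: "\<exists>n. s n > b" for b
  proof (rule ccontr)
    assume "\<not> ?thesis"
    then have "summable \<mu>"
      by (intro bounded_imp_summable[of \<mu> b] \<mu>) (metis s_def not_less lessThan_Suc_atMost)
    with div show False by contradiction
  qed
  have bounded: "AE z in M. \<not> (\<forall>n. S n z \<le> real B)" for B
  proof -
    have "prob {z \<in> space M. \<forall>n. S n z \<le> real B} \<le> e" if e: "e > 0" for e
    proof -
      \<comment> \<open>The first threshold gives \<open>s n - real B \<ge> s n / 2\<close>; the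
        second makes the resulting Chebyshev bound \<open>4 * C / s n\<close> at most
        \<open>e\<close>.\<close>
      obtain n where n: "s n > max (2 * real B + 1) (4 * C / e)" using unb by blast
      then have d: "s n - real B > 0" "s n > 0" by auto
      have "prob {z \<in> space M. \<forall>n. S n z \<le> real B} \<le> prob {z \<in> space M. s n - real B \<le> \<bar>S n z - expectation (S n)\<bar>}"
      proof (rule finite_measure_mono)
        have "s n - real B \<le> \<bar>S n z - s n\<bar>" if "S n z \<le> real B" for z
          using that d by linarith
        then show "{z \<in> space M. \<forall>n. S n z \<le> real B} \<subseteq> {z \<in> space M. s n - real B \<le> \<bar>S n z - expectation (S n)\<bar>}"
          unfolding ES by auto
      qed measurable
      also have "\<dots> \<le> variance (S n) / (s n - real B)\<^sup>2"
        by (rule Chebyshev_inequality) (use intS2 d in auto)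
      also have "\<dots> \<le> (C * s n) / (s n / 2)\<^sup>2"
        using n d C var[of n] by (intro frac_le power_mono) auto
      also have "\<dots> = 4 * C / s n"
        using d by (simp add: power2_eq_square field_simps)
      also have "\<dots> \<le> e"
        using n d e by (simp add: field_simps)
      finally show ?thesis .
    qed
    then have "prob {z \<in> space M. \<forall>n. S n z \<le> real B} = 0"
      by (meson field_le_epsilon measure_nonneg order_antisym add_0 dense_ge)
    then show ?thesis
      by (subst (asm) prob_eq_0) (auto elim!: eventually_mono)
  qed
  have "AE z in M. \<forall>B. \<not> (\<forall>n. S n z \<le> real B)"
    unfolding AE_all_countable using bounded by blast
  then show ?thesis
  proof (rule eventually_mono)
    fix z assume *: "\<forall>B. \<not> (\<forall>n. S n z \<le> real B)"
    show "\<not> summable (\<lambda>i. X i z)"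
    proof
      assume "summable (\<lambda>i. X i z)"
      then have "S n z \<le> (\<Sum>i. X i z)" for n
        unfolding S_def by (intro sum_le_suminf) (auto simp: nonneg)
      moreover obtain B where "(\<Sum>i. X i z) \<le> real B" using real_arch_simple by blast
      ultimately show False using * order_trans by blast
    qed
  qed
qed

section \<open>Residue counts, integer multiples and valuations\<close>

text \<open>Among \<open>d\<close> consecutive integers exactly one lies in the residue class of
  \<open>k\<close>, and the interval consists of \<open>q\<close> such runs.\<close>

lemma card_dvd_diff_interval:
  assumes "d > 0"
  shows "card {l \<in> {a..<a + d * q}. int d dvd int l - k} = q"
proof (induction q)
  case (Suc q)
  define b where "b = a + d * q"
  define l0 where "l0 = b + nat ((k - int b) mod int d)"
  have "{l \<in> {b..<b + d}. int d dvd int l - k} = {l0}"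
  proof (intro equalityI subsetI)
    fix l assume "l \<in> {l \<in> {b..<b + d}. int d dvd int l - k}"
    then have l: "b \<le> l" "l < b + d" "int d dvd int l - k" by auto
    have "int d dvd (int l - int b) - (k - int b)" using l by simp
    then have "(int l - int b) mod int d = (k - int b) mod int d"
      by (simp add: mod_eq_dvd_iff)
    then show "l \<in> {l0}" using l by (simp add: l0_def)
  next
    fix l assume "l \<in> {l0}"
    then have l: "l = l0" by simp
    have m: "0 \<le> (k - int b) mod int d" "(k - int b) mod int d < int d" using assms by auto
    then have "int l = int b + (k - int b) mod int d" by (simp add: l l0_def)
    then have "int l - k = - (k - int b - (k - int b) mod int d)" by simp
    then have "int d dvd int l - k"
      by (metis dvd_minus_iff dvd_minus_mod)
    then show "l \<in> {l \<in> {b..<b + d}. int d dvd int l - k}" using m by (auto simp: l l0_def)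
  qed
  moreover have "{l \<in> {a..<a + d * Suc q}. int d dvd int l - k} =
      {l \<in> {a..<a + d * q}. int d dvd int l - k} \<union> {l \<in> {b..<b + d}. int d dvd int l - k}"
    by (auto simp: b_def)
  moreover have "{l \<in> {a..<a + d * q}. int d dvd int l - k} \<inter> {l \<in> {b..<b + d}. int d dvd int l - k} = {}"
    by (auto simp: b_def)
  ultimately show ?case
    using Suc by (simp add: card_Un_disjoint)
qed simp

lemma padic_eq_0_iff_dvd:
  assumes "x \<in> carrier (padic_int p)" "N \<le> L"
  shows "x N = 0 \<longleftrightarrow> int p ^ N dvd x L"
  using padic_level_mod[OF assms] by (simp add: dvd_eq_mod_eq_0)

text \<open>Integer multiples written coordinatewise, so that measurability and congruences can be
  checked level by level. For \<open>n = int k\<close> they agree on the carrier with the multiples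
  in \<open>Gamma_b\<close>, see \<open>add_pow_eq_scale\<close>.\<close>

definition padic_scale :: "nat \<Rightarrow> int \<Rightarrow> (nat \<Rightarrow> int) \<Rightarrow> nat \<Rightarrow> int" where
  "padic_scale p n x = (\<lambda>N. (n * x N) mod int p ^ N)"

definition padic_val_eq :: "nat \<Rightarrow> nat \<Rightarrow> (nat \<Rightarrow> int) set" where
  "padic_val_eq p r = {x \<in> carrier (padic_int p). x r = 0 \<and> x (Suc r) \<noteq> 0}"

section \<open>Measurability and translation invariance on the \<open>p\<close>-adic
  integers\<close>

locale padic_haar =
  fixes p :: nat and M :: "(nat \<Rightarrow> int) measure"
  assumes prime_p: "prime p" and haar: "padic_haar_measure p M"
begin

abbreviation plus_p (infixl "+\<^sub>p" 65) where "x +\<^sub>p y \<equiv> x \<oplus>\<^bsub>padic_int p\<^esub> y"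
abbreviation scale_p (infixr "*\<^sub>p" 70) where "n *\<^sub>p x \<equiv> padic_scale p n x"
abbreviation "Z \<equiv> carrier (padic_int p)"
abbreviation "V \<equiv> padic_val_eq p"

lemma p_gt_1: "p > 1"
  using prime_p by (rule prime_gt_1_nat)

lemma p_pos: "p > 0"
  using p_gt_1 by simp

lemma p_pow_pos: "int p ^ N > 0"
  using p_pos by simp

sublocale Z: cring "padic_int p"
  by (rule padic_int_cring[OF p_pos])

lemma sets_M: "sets M = sets (restrict_space borel Z)"
  using haar by (simp add: padic_haar_measure_def)

lemma space_M: "space M = Z"
  using sets_eq_imp_space_eq[OF sets_M] by (simp add: space_restrict_space)

sublocale prob_space M
  by (rule prob_spaceI) (use haar space_M in \<open>simp add: padic_haar_measure_def\<close>)

lemma coord_measurable [measurable]: "(\<lambda>x. x N) \<in> M \<rightarrow>\<^sub>M count_space UNIV"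
proof -
  have "(\<lambda>x. x N) \<in> M \<rightarrow>\<^sub>M (borel :: int measure)"
    unfolding measurable_cong_sets[OF sets_M refl] by (rule padic_coord_measurable)
  moreover have "(\<lambda>z. z) \<in> (borel :: int measure) \<rightarrow>\<^sub>M count_space UNIV"
    unfolding measurable_def by (auto intro: borel_open[OF Topological_Spaces.open_discrete])
  ultimately show ?thesis by (rule measurable_compose)
qed

lemma measurable_into_M:
  fixes h :: "'a \<Rightarrow> nat \<Rightarrow> int"
  assumes "\<And>N. (\<lambda>z. h z N) \<in> L \<rightarrow>\<^sub>M count_space UNIV" "\<And>z. z \<in> space L \<Longrightarrow> h z \<in> Z"
  shows "h \<in> L \<rightarrow>\<^sub>M M"
proof -
  have "h \<in> L \<rightarrow>\<^sub>M restrict_space borel Z"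
    by (intro measurable_into_padic assms(2) measurable_compose[OF assms(1)]) auto
  then show ?thesis
    using measurable_cong_sets[OF refl sets_M] by blast
qed

lemma cylinder_sets [measurable]: "padic_cylinder p N c \<in> sets M"
  unfolding sets_M sets_borel_padic by (auto intro: sigma_sets.Basic)

lemma scale_closed [simp]:
  assumes "x \<in> Z"
  shows "n *\<^sub>p x \<in> Z"
proof -
  have "(n * x (Suc N)) mod int p ^ N = (n * x N) mod int p ^ N" for N
    using assms by (metis padic_carrier mod_mult_right_eq)
  then show ?thesis
    unfolding padic_carrier padic_scale_def
    using p_pow_pos by (simp add: padic_mod_Suc del: power_Suc)
qed

lemma scale_measurable [measurable]: "(\<lambda>x. n *\<^sub>p x) \<in> M \<rightarrow>\<^sub>M M"
proof (rule measurable_into_M)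
  show "(\<lambda>x. (n *\<^sub>p x) N) \<in> M \<rightarrow>\<^sub>M count_space UNIV" for N
    unfolding padic_scale_def by (rule measurable_compose[OF coord_measurable]) simp
qed (simp add: space_M)

lemma add_measurable [measurable]:
  assumes [measurable]: "g \<in> L \<rightarrow>\<^sub>M M" "h \<in> L \<rightarrow>\<^sub>M M"
  shows "(\<lambda>z. g z +\<^sub>p h z) \<in> L \<rightarrow>\<^sub>M M"
proof (rule measurable_into_M)
  fix N
  have [measurable]: "(\<lambda>z. g z N) \<in> L \<rightarrow>\<^sub>M count_space UNIV" "(\<lambda>z. h z N) \<in> L \<rightarrow>\<^sub>M count_space UNIV"
    by (rule measurable_compose[OF _ coord_measurable], measurable)+
  \<comment> \<open>The coordinate of \<open>g\<close> has countably many values, so it suffices to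
    treat the sum with that coordinate frozen at \<open>a\<close>.\<close>
  have "(\<lambda>z. (a + h z N) mod int p ^ N) \<in> L \<rightarrow>\<^sub>M count_space UNIV" for a
    by (rule measurable_compose[where f = "\<lambda>z. h z N"]) measurable
  then show "(\<lambda>z. (g z +\<^sub>p h z) N) \<in> L \<rightarrow>\<^sub>M count_space UNIV"
    unfolding padic_add
    by (rule measurable_compose_countable[where g = "\<lambda>z. g z N"]) measurable
next
  fix z assume "z \<in> space L"
  with assms show "g z +\<^sub>p h z \<in> Z"
    using measurable_space[of g L M z] measurable_space[of h L M z] by (simp add: space_M)
qed

lemma add_pow_eq_scale:
  assumes "x \<in> Z"
  shows "[k] \<cdot>\<^bsub>padic_int p\<^esub> x = int k *\<^sub>p x"
proof (induction k)
  case 0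
  have "[(0::nat)] \<cdot>\<^bsub>padic_int p\<^esub> x = \<zero>\<^bsub>padic_int p\<^esub>" by (rule Z.add.nat_pow_0)
  then show ?case by (simp add: padic_scale_def) (simp add: padic_int_def)
next
  case (Suc k)
  have "[(Suc k)] \<cdot>\<^bsub>padic_int p\<^esub> x = ([k] \<cdot>\<^bsub>padic_int p\<^esub> x) +\<^sub>p x" by (rule Z.add.nat_pow_Suc)
  then show ?case
    unfolding Suc by (auto simp: padic_scale_def padic_add mod_simps algebra_simps)
qed

text \<open>Passing to the base point \<open>x + k a\<close> leaves only the difference of two
  times; pair correlations are reduced to this form.\<close>

lemma add_scale_shift: "x +\<^sub>p (k + n) *\<^sub>p a = (x +\<^sub>p k *\<^sub>p a) +\<^sub>p n *\<^sub>p a"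
  by (rule ext) (simp add: padic_scale_def padic_add mod_simps distrib_right add.assoc)

text \<open>The preimage of \<open>A\<close> under translation by \<open>b\<close> is its image
  under translation by \<open>-b\<close>, and \<open>padic_haar_measure\<close> is stated for
  images.\<close>

lemma emeasure_translate:
  assumes "b \<in> Z" "A \<in> sets M"
  shows "emeasure M {x \<in> Z. x +\<^sub>p b \<in> A} = emeasure M A"
proof -
  have AZ: "A \<subseteq> Z" using assms sets.sets_into_space space_M by auto
  have "{x \<in> Z. x +\<^sub>p b \<in> A} = (\<lambda>x. (\<ominus>\<^bsub>padic_int p\<^esub> b) +\<^sub>p x) ` A"
  proof (intro equalityI subsetI)
    fix x assume "x \<in> {x \<in> Z. x +\<^sub>p b \<in> A}"
    then show "x \<in> (\<lambda>x. (\<ominus>\<^bsub>padic_int p\<^esub> b) +\<^sub>p x) ` A"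
      using assms(1) by (intro image_eqI[of _ _ "x +\<^sub>p b"]) (auto simp: Z.r_neg1 Z.a_comm)
  next
    fix x assume "x \<in> (\<lambda>x. (\<ominus>\<^bsub>padic_int p\<^esub> b) +\<^sub>p x) ` A"
    then obtain y where "y \<in> A" "y \<in> Z" "x = (\<ominus>\<^bsub>padic_int p\<^esub> b) +\<^sub>p y" using AZ by auto
    then show "x \<in> {x \<in> Z. x +\<^sub>p b \<in> A}"
      using assms(1) by (auto simp: Z.r_neg2 Z.a_comm[of _ b])
  qed
  then show ?thesis
    using haar assms by (simp add: padic_haar_measure_def)
qed

text \<open>The \<open>p ^ N\<close> cylinders of level \<open>N\<close> partition the group and are
  translates of one another, so they share the total mass 1 equally.\<close>

lemma measure_cylinder:
  assumes "c \<in> {0..<int p ^ N}"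
  shows "measure M (padic_cylinder p N c) = 1 / real p ^ N"
proof -
  have const: "measure M (padic_cylinder p N d) = measure M (padic_cylinder p N 0)"
    if d: "d \<in> {0..<int p ^ N}" for d
  proof -
    \<comment> \<open>\<open>b\<close> is the integer \<open>d\<close> as an element of
      \<open>Z\<close>; translating by it carries the cylinder of 0 to that of
      \<open>d\<close>.\<close>
    define b where "b = (\<lambda>L. d mod int p ^ L)"
    have b: "b \<in> Z"
      unfolding padic_carrier b_def using p_pow_pos by (simp add: padic_mod_Suc del: power_Suc)
    have "{x \<in> Z. x +\<^sub>p b \<in> padic_cylinder p N d} = padic_cylinder p N 0"
    proof -
      have "(x N + d) mod int p ^ N = d \<longleftrightarrow> x N = 0" if "x \<in> Z" for x
      proof -
        have x: "0 \<le> x N" "x N < int p ^ N" using that by (auto simp: padic_carrier)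
        have "(x N + d) mod int p ^ N = d \<longleftrightarrow> (x N + d) mod int p ^ N = d mod int p ^ N"
          using d by simp
        also have "\<dots> \<longleftrightarrow> int p ^ N dvd x N" by (simp add: mod_eq_dvd_iff)
        also have "\<dots> \<longleftrightarrow> x N = 0" using x zdvd_not_zless by force
        finally show ?thesis .
      qed
      then show ?thesis
        using b Z.a_closed[OF _ b] by (auto simp: padic_cylinder_def padic_add b_def mod_add_right_eq)
    qed
    with emeasure_translate[OF b cylinder_sets, of N d] show ?thesis by (simp add: measure_def)
  qed
  have "1 = measure M (\<Union>d\<in>{0..<int p ^ N}. padic_cylinder p N d)"
  proof -
    have "(\<Union>d\<in>{0..<int p ^ N}. padic_cylinder p N d) = space M"
      by (auto simp: padic_cylinder_def space_M padic_carrier)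
    then show ?thesis by (simp add: prob_space)
  qed
  also have "\<dots> = (\<Sum>d\<in>{0..<int p ^ N}. measure M (padic_cylinder p N d))"
    by (rule finite_measure_finite_Union) (auto simp: disjoint_family_on_def, auto simp: padic_cylinder_def)
  also have "\<dots> = (\<Sum>d\<in>{0..<int p ^ N}. measure M (padic_cylinder p N 0))"
    by (rule sum.cong) (simp_all only: const)
  also have "\<dots> = real p ^ N * measure M (padic_cylinder p N 0)"
    by (simp add: nat_power_eq)
  finally show ?thesis using const[OF assms] p_pos by (simp add: field_simps)
qed

lemma emeasure_cylinder:
  assumes "c \<in> {0..<int p ^ N}"
  shows "emeasure M (padic_cylinder p N c) = ennreal (1 / real p ^ N)"
  using measure_cylinder[OF assms] by (simp add: emeasure_eq_measure)

lemma V_eq: "V r = padic_cylinder p r 0 - padic_cylinder p (Suc r) 0"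
  by (auto simp: padic_val_eq_def padic_cylinder_def)

lemma V_sets [measurable]: "V r \<in> sets M"
  unfolding V_eq by measurable

lemma measure_V: "measure M (V r) = (1 - 1 / real p) / real p ^ r"
proof -
  have sub: "padic_cylinder p (Suc r) 0 \<subseteq> padic_cylinder p r 0"
    using padic_eq_0_iff_dvd[of _ p r "Suc r"] by (auto simp: padic_cylinder_def)
  show ?thesis
    unfolding V_eq using p_pos measure_cylinder[of 0 "Suc r"] measure_cylinder[of 0 r]
    by (subst finite_measure_Diff[OF _ _ sub]) (auto simp: field_simps)
qed

section \<open>Multiplication by integers and Haar measure\<close>

text \<open>The factor \<open>p ^ v\<close> cancels in the divisibility and \<open>m\<close> is
  invertible modulo powers of \<open>p\<close>, so the valuation rises by exactly
  \<open>v\<close>.\<close>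

lemma scale_eq_0_iff:
  assumes "a \<in> Z" "coprime m (int p)"
  shows "((int p ^ v * m) *\<^sub>p a) (N + v) = 0 \<longleftrightarrow> a N = 0"
proof -
  have "((int p ^ v * m) *\<^sub>p a) (N + v) = 0 \<longleftrightarrow> int p ^ v * int p ^ N dvd int p ^ v * (m * a (N + v))"
    by (simp add: padic_scale_def dvd_eq_mod_eq_0 power_add mult_ac)
  also have "\<dots> \<longleftrightarrow> int p ^ N dvd m * a (N + v)"
    using p_pos by (subst dvd_mult_cancel_left) auto
  also have "\<dots> \<longleftrightarrow> int p ^ N dvd a (N + v)"
    using assms(2) by (intro coprime_dvd_mult_right_iff) (simp add: coprime_commute)
  also have "\<dots> \<longleftrightarrow> a N = 0"
    using padic_eq_0_iff_dvd[OF assms(1), of N "N + v"] by simp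
  finally show ?thesis .
qed

lemma scale_in_V_iff:
  assumes "a \<in> Z" "coprime m (int p)"
  shows "(int p ^ v * m) *\<^sub>p a \<in> V (r + v) \<longleftrightarrow> a \<in> V r"
  using scale_eq_0_iff[OF assms, of v r] scale_eq_0_iff[OF assms, of v "Suc r"] assms(1)
  by (simp add: padic_val_eq_def)

text \<open>Solving \<open>p ^ v * m * x = c\<close> modulo \<open>p ^ N\<close> gives
  \<open>distr_scale\<close> on the generating cylinders.\<close>

lemma emeasure_scale_vimage_cylinder:
  assumes m: "coprime m (int p)" and c: "c \<in> {0..<int p ^ N}"
  shows "emeasure M {x \<in> Z. (int p ^ v * m) *\<^sub>p x \<in> padic_cylinder p N c}
    = ennreal (real p ^ v) * emeasure M (padic_cylinder p v 0 \<inter> padic_cylinder p N c)"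
proof -
  have vim: "{x \<in> Z. (int p ^ v * m) *\<^sub>p x \<in> padic_cylinder p N c}
      = {x \<in> Z. (int p ^ v * m * x N) mod int p ^ N = c}"
    by (auto simp: padic_cylinder_def) (auto simp: padic_scale_def)
  \<comment> \<open>If \<open>N \<le> v\<close>, the product vanishes modulo \<open>p ^ N\<close>,
    so all \<open>x\<close> or none are solutions. If \<open>v \<le> N\<close>, a solution requires
    \<open>p ^ v\<close> to divide \<open>c\<close>, and then \<open>x\<close> is determined modulo
    \<open>p ^ (N - v)\<close>.\<close>
  consider "N \<le> v" "c = 0" | "N \<le> v" "c \<noteq> 0" | "v \<le> N" "int p ^ v dvd c" | "v \<le> N" "\<not> int p ^ v dvd c"
    by linarith
  then show ?thesis
  proof cases
    case 1
    then have "{x \<in> Z. (int p ^ v * m * x N) mod int p ^ N = c} = space M"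
      by (auto simp: space_M dvd_eq_mod_eq_0[symmetric] intro!: dvd_mult2 le_imp_power_dvd)
    moreover have "padic_cylinder p v 0 \<inter> padic_cylinder p N c = padic_cylinder p v 0"
      using padic_eq_0_iff_dvd[OF _ 1(1)] 1(2) by (auto simp: padic_cylinder_def)
    moreover have "ennreal (real p ^ v) * ennreal (1 / real p ^ v) = 1"
      using p_pos by (simp flip: ennreal_mult)
    ultimately show ?thesis
      using p_pos by (simp add: vim emeasure_cylinder emeasure_space_1)
  next
    case 2
    then have "{x \<in> Z. (int p ^ v * m * x N) mod int p ^ N = c} = {}"
    proof -
      have "(int p ^ v * m * x N) mod int p ^ N = 0" for x :: "nat \<Rightarrow> int"
        using 2 by (auto simp: dvd_eq_mod_eq_0[symmetric] intro!: dvd_mult2 le_imp_power_dvd)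
      then show ?thesis using 2 by auto
    qed
    moreover have "padic_cylinder p v 0 \<inter> padic_cylinder p N c = {}"
      using padic_eq_0_iff_dvd[OF _ 2(1)] 2(2) by (fastforce simp: padic_cylinder_def)
    ultimately show ?thesis by (simp only: vim emeasure_empty mult_zero_right)
  next
    case 3
    obtain c' where c': "c = int p ^ v * c'" using 3 by (elim dvdE)
    define L where "L = N - v"
    have N: "N = v + L" using 3 by (simp add: L_def)
    \<comment> \<open>An inverse of \<open>m\<close> modulo \<open>p ^ L\<close> turns
      \<open>m * x = c'\<close> into \<open>x = m' * c'\<close>, which gives the residue
      \<open>d\<close>.\<close>
    obtain m' where m': "[m * m' = 1] (mod int p ^ L)"
      using cong_solve_coprime_int[of m "int p ^ L"] m by auto
    define d where "d = (m' * c') mod int p ^ L"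
    have d: "d \<in> {0..<int p ^ L}" using p_pow_pos by (simp add: d_def)
    have "(int p ^ v * m * x N) mod int p ^ N = c \<longleftrightarrow> x L = d" if x: "x \<in> Z" for x
    proof -
      have "(int p ^ v * m * x N) mod int p ^ N = c \<longleftrightarrow> [int p ^ v * m * x N = c] (mod int p ^ N)"
        using c by (simp add: cong_def)
      also have "\<dots> \<longleftrightarrow> int p ^ v * int p ^ L dvd int p ^ v * (m * x N - c')"
        by (simp add: cong_iff_dvd_diff c' N power_add algebra_simps)
      also have "\<dots> \<longleftrightarrow> int p ^ L dvd m * x N - c'"
        using p_pos by (subst dvd_mult_cancel_left) auto
      also have "\<dots> \<longleftrightarrow> [m * x N = c'] (mod int p ^ L)"
        by (simp add: cong_iff_dvd_diff)
      also have "\<dots> \<longleftrightarrow> [x N = m' * c'] (mod int p ^ L)"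
      proof
        assume "[m * x N = c'] (mod int p ^ L)"
        then have "[m' * (m * x N) = m' * c'] (mod int p ^ L)" by (rule cong_scalar_left)
        moreover have "[m * m' * x N = 1 * x N] (mod int p ^ L)" using m' by (rule cong_scalar_right)
        ultimately show "[x N = m' * c'] (mod int p ^ L)"
          by (simp add: mult_ac) (metis cong_sym cong_trans)
      next
        assume "[x N = m' * c'] (mod int p ^ L)"
        then have "[m * x N = m * (m' * c')] (mod int p ^ L)" by (rule cong_scalar_left)
        moreover have "[m * m' * c' = 1 * c'] (mod int p ^ L)" using m' by (rule cong_scalar_right)
        ultimately show "[m * x N = c'] (mod int p ^ L)"
          by (simp add: mult_ac) (metis cong_sym cong_trans)
      qed
      also have "\<dots> \<longleftrightarrow> x L = d"
        using padic_level_mod[OF x, of L N] N by (simp add: cong_def d_def)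
      finally show ?thesis .
    qed
    then have "{x \<in> Z. (int p ^ v * m * x N) mod int p ^ N = c} = padic_cylinder p L d"
      by (auto simp: padic_cylinder_def)
    moreover have "padic_cylinder p v 0 \<inter> padic_cylinder p N c = padic_cylinder p N c"
      using padic_eq_0_iff_dvd[OF _ 3(1)] 3(2) by (auto simp: padic_cylinder_def)
    moreover have "ennreal (real p ^ v) * ennreal (1 / real p ^ N) = ennreal (1 / real p ^ L)"
      using p_pos by (simp add: N power_add flip: ennreal_mult)
    ultimately show ?thesis
      using c d by (simp add: vim emeasure_cylinder del: atLeastLessThan_iff)
  next
    case 4
    have "{x \<in> Z. (int p ^ v * m * x N) mod int p ^ N = c} = {}"
    proof -
      have "int p ^ v dvd (int p ^ v * m * x N) mod int p ^ N" for x :: "nat \<Rightarrow> int"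
        using 4 by (intro dvd_mod) (simp_all add: mult.assoc le_imp_power_dvd)
      then show ?thesis using 4 by auto
    qed
    moreover have "padic_cylinder p v 0 \<inter> padic_cylinder p N c = {}"
      using padic_eq_0_iff_dvd[OF _ 4(1)] 4(2) by (auto simp: padic_cylinder_def)
    ultimately show ?thesis by (simp only: vim emeasure_empty mult_zero_right)
  qed
qed

text \<open>Multiplication by \<open>m\<close> preserves Haar measure, and \<open>p ^ v\<close>
  compresses the group onto a subgroup of index \<open>p ^ v\<close>, hence the density. Both
  measures agree on cylinders, which generate and are stable under intersection.\<close>

lemma distr_scale:
  assumes m: "coprime m (int p)"
  shows "distr M M (\<lambda>x. (int p ^ v * m) *\<^sub>p x) =
    density M (\<lambda>x. ennreal (real p ^ v) * indicator (padic_cylinder p v 0) x)"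
    (is "?L = ?R")
proof (rule measure_eqI_generator_eq[OF Int_stable_padic_cylinder])
  show "range (case_prod (padic_cylinder p)) \<subseteq> Pow Z"
    by (auto simp: padic_cylinder_def)
  show "sets ?L = sigma_sets Z (range (case_prod (padic_cylinder p)))"
    "sets ?R = sigma_sets Z (range (case_prod (padic_cylinder p)))"
    by (simp_all add: sets_M sets_borel_padic)
  show "range (\<lambda>i::nat. padic_cylinder p 0 0) \<subseteq> range (case_prod (padic_cylinder p))"
    by auto
  show "(\<Union>i::nat. padic_cylinder p 0 0) = Z"
  proof -
    have "x 0 = 0" if "x \<in> Z" for x
      using that[unfolded padic_carrier, rule_format, of 0] by simp
    then show ?thesis by (auto simp: padic_cylinder_def)
  qed
  show "emeasure ?L (padic_cylinder p 0 0) \<noteq> \<infinity>" for i :: nat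
    by (simp add: emeasure_distr)
  fix X assume "X \<in> range (case_prod (padic_cylinder p))"
  then obtain N c where X: "X = padic_cylinder p N c" by auto
  show "emeasure ?L X = emeasure ?R X"
  proof (cases "c \<in> {0..<int p ^ N}")
    case True
    have "emeasure ?L X = emeasure M {x \<in> Z. (int p ^ v * m) *\<^sub>p x \<in> X}"
      by (simp add: X emeasure_distr vimage_def Int_def space_M conj_commute)
    also have "\<dots> = ennreal (real p ^ v) * emeasure M (padic_cylinder p v 0 \<inter> X)"
      unfolding X by (rule emeasure_scale_vimage_cylinder[OF m True])
    also have "\<dots> = (\<integral>\<^sup>+x. ennreal (real p ^ v) * indicator (padic_cylinder p v 0 \<inter> X) x \<partial>M)"
      by (subst nn_integral_cmult_indicator) (simp_all add: X)
    also have "\<dots> = emeasure ?R X"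
      by (subst emeasure_density) (auto simp: X indicator_inter_arith mult_ac)
    finally show ?thesis .
  qed (simp add: X padic_cylinder_empty)
qed

section \<open>Pair correlations along the orbits of rotations\<close>

sublocale Q: pair_prob_space M M ..

text \<open>For fixed \<open>\<alpha>\<close>, translation by \<open>k \<alpha>\<close> removes
  \<open>k\<close> from both conditions. Substituting \<open>b = (l - k) \<alpha>\<close> then
  brings in the density of \<open>distr_scale\<close> and raises the valuation from \<open>r\<close>
  to \<open>r + v\<close>.\<close>

lemma emeasure_pair_scale:
  assumes [measurable]: "A \<in> sets M" "B \<in> sets M" and m: "coprime m (int p)"
    and n: "l - k = int p ^ v * m"
  shows "emeasure (M \<Otimes>\<^sub>M M) {z \<in> Z \<times> Z. fst z \<in> V r \<and>
      snd z +\<^sub>p k *\<^sub>p fst z \<in> A \<and> snd z +\<^sub>p l *\<^sub>p fst z \<in> B} =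
    ennreal (real p ^ v) * emeasure (M \<Otimes>\<^sub>M M)
      {z \<in> Z \<times> Z. fst z \<in> V (r + v) \<and> snd z \<in> A \<and> snd z +\<^sub>p fst z \<in> B}"
    (is "emeasure _ ?S = _ * emeasure _ ?T")
proof -
  let ?n = "int p ^ v * m"
  have l: "l = k + ?n" using n by simp
  \<comment> \<open>The correlation of \<open>A\<close> and \<open>B\<close> at distance
    \<open>b\<close>: the integrand in the new variable.\<close>
  define \<psi> where "\<psi> b = emeasure M {x \<in> Z. x \<in> A \<and> x +\<^sub>p b \<in> B}" for b
  have sp: "Z \<times> Z = space (M \<Otimes>\<^sub>M M)" by (simp add: space_pair_measure space_M)
  have D: "{z \<in> Z \<times> Z. snd z \<in> A \<and> snd z +\<^sub>p fst z \<in> B} \<in> sets (M \<Otimes>\<^sub>M M)"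
    unfolding sp by measurable
  have "(\<lambda>b. emeasure M (Pair b -` {z \<in> Z \<times> Z. snd z \<in> A \<and> snd z +\<^sub>p fst z \<in> B})) \<in> borel_measurable M"
    by (rule measurable_emeasure_Pair[OF D])
  also have "?this \<longleftrightarrow> \<psi> \<in> borel_measurable M"
    unfolding \<psi>_def by (intro measurable_cong arg_cong[where f = "emeasure M"]) (auto simp: space_M)
  finally have [measurable]: "\<psi> \<in> borel_measurable M" .
  have S: "?S \<in> sets (M \<Otimes>\<^sub>M M)" and T: "?T \<in> sets (M \<Otimes>\<^sub>M M)"
    unfolding sp by measurable
  have "emeasure (M \<Otimes>\<^sub>M M) ?S = (\<integral>\<^sup>+a. emeasure M (Pair a -` ?S) \<partial>M)"
    by (rule emeasure_pair_measure_alt[OF S])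
  also have "\<dots> = (\<integral>\<^sup>+a. indicator (V (r + v)) (?n *\<^sub>p a) * \<psi> (?n *\<^sub>p a) \<partial>M)"
  proof (rule nn_integral_cong)
    fix a assume "a \<in> space M"
    then have a: "a \<in> Z" by (simp add: space_M)
    define W where "W = {x \<in> Z. x \<in> A \<and> x +\<^sub>p ?n *\<^sub>p a \<in> B}"
    have "Pair a -` ?S = (if a \<in> V r then {x \<in> Z. x +\<^sub>p k *\<^sub>p a \<in> W} else {})"
      using a add_scale_shift[of _ k ?n a] by (auto simp: l W_def)
    moreover have "W \<in> sets M"
    proof -
      have "?n *\<^sub>p a \<in> space M" using a by (simp add: space_M)
      then have [measurable]: "(\<lambda>x. ?n *\<^sub>p a) \<in> M \<rightarrow>\<^sub>M M" by simp
      show ?thesis unfolding W_def space_M[symmetric] by measurable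
    qed
    ultimately show "emeasure M (Pair a -` ?S) = indicator (V (r + v)) (?n *\<^sub>p a) * \<psi> (?n *\<^sub>p a)"
      using scale_in_V_iff[OF a m, of v r] emeasure_translate[OF scale_closed[OF a, of k]]
      by (simp add: \<psi>_def W_def[symmetric])
  qed
  also have "\<dots> = (\<integral>\<^sup>+b. indicator (V (r + v)) b * \<psi> b \<partial>distr M M (\<lambda>x. ?n *\<^sub>p x))"
    by (subst nn_integral_distr) simp_all
  also have "\<dots> = (\<integral>\<^sup>+b. ennreal (real p ^ v) * (indicator (V (r + v)) b * \<psi> b) \<partial>M)"
  proof -
    \<comment> \<open>Elements of valuation \<open>r + v\<close> are divisible by
      \<open>p ^ v\<close>, so the density is constant where the integrand is supported.\<close>
    have "indicator (padic_cylinder p v 0) b * indicator (V (r + v)) b = (indicator (V (r + v)) b :: ennreal)" for b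
      using padic_eq_0_iff_dvd[of b p v "r + v"]
      by (auto simp: indicator_def padic_val_eq_def padic_cylinder_def)
    then have "ennreal (real p ^ v) * indicator (padic_cylinder p v 0) b * (indicator (V (r + v)) b * \<psi> b)
      = ennreal (real p ^ v) * (indicator (V (r + v)) b * \<psi> b)" for b
      by (metis mult.assoc)
    then show ?thesis
      unfolding distr_scale[OF m] by (subst nn_integral_density) simp_all
  qed
  also have "\<dots> = ennreal (real p ^ v) * (\<integral>\<^sup>+b. indicator (V (r + v)) b * \<psi> b \<partial>M)"
    by (rule nn_integral_cmult) measurable
  also have "(\<integral>\<^sup>+b. indicator (V (r + v)) b * \<psi> b \<partial>M) = (\<integral>\<^sup>+b. emeasure M (Pair b -` ?T) \<partial>M)"
  proof (rule nn_integral_cong)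
    fix b assume "b \<in> space M"
    then have "Pair b -` ?T = (if b \<in> V (r + v) then {x \<in> Z. x \<in> A \<and> x +\<^sub>p b \<in> B} else {})"
      by (auto simp: space_M)
    then show "indicator (V (r + v)) b * \<psi> b = emeasure M (Pair b -` ?T)"
      by (simp add: \<psi>_def)
  qed
  also have "\<dots> = emeasure (M \<Otimes>\<^sub>M M) ?T"
    by (rule emeasure_pair_measure_alt[OF T, symmetric])
  finally show ?thesis .
qed

text \<open>In a pair \<open>z\<close> the first component is the rotation \<open>\<alpha>\<close>,
  the second the starting point \<open>x\<close>.\<close>

definition hit :: "(nat \<Rightarrow> int) set \<Rightarrow> nat \<Rightarrow> ((nat \<Rightarrow> int) \<times> (nat \<Rightarrow> int)) set" where
  "hit A k = {z \<in> Z \<times> Z. snd z +\<^sub>p int k *\<^sub>p fst z \<in> A}"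

abbreviation "MM \<equiv> M \<Otimes>\<^sub>M M"

lemma space_MM: "space MM = Z \<times> Z"
  by (simp add: space_pair_measure space_M)

lemma Z_sets [measurable]: "Z \<in> sets M"
  using sets.top[of M] by (simp only: space_M)

lemma hit_sets [measurable]:
  assumes [measurable]: "A \<in> sets M"
  shows "hit A k \<in> sets MM"
  unfolding hit_def space_MM[symmetric] by measurable

lemma measure_V_hit:
  assumes A [measurable]: "A \<in> sets M"
  shows "measure MM (V r \<times> Z \<inter> hit A k) = measure M (V r) * measure M A"
proof -
  have VZ: "V r \<times> Z \<in> sets MM" using space_M by (metis V_sets pair_measureI sets.top)
  have "emeasure MM (V r \<times> Z \<inter> hit A k) = (\<integral>\<^sup>+a. emeasure M (Pair a -` (V r \<times> Z \<inter> hit A k)) \<partial>M)"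
    by (rule emeasure_pair_measure_alt) (use VZ in measurable)
  also have "\<dots> = (\<integral>\<^sup>+a. emeasure M A * indicator (V r) a \<partial>M)"
  proof (rule nn_integral_cong)
    fix a assume "a \<in> space M"
    then have a: "a \<in> Z" by (simp add: space_M)
    then have "Pair a -` (V r \<times> Z \<inter> hit A k) = (if a \<in> V r then {x \<in> Z. x +\<^sub>p int k *\<^sub>p a \<in> A} else {})"
      by (auto simp: hit_def)
    then show "emeasure M (Pair a -` (V r \<times> Z \<inter> hit A k)) = emeasure M A * indicator (V r) a"
      using emeasure_translate[OF scale_closed[OF a, of "int k"] A] by simp
  qed
  also have "\<dots> = emeasure M A * emeasure M (V r)"
    by (rule nn_integral_cmult_indicator) simp
  finally show ?thesis
    by (simp add: measure_def enn2real_mult mult.commute)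
qed

text \<open>The indices are sorted by the valuation \<open>v\<close> of \<open>l - k\<close>, which
  is below \<open>j\<close>. By \<open>emeasure_pair_scale\<close> each contributes
  \<open>p ^ v\<close> times the measure of \<open>T v\<close>, and at most
  \<open>(p - 1) * p ^ (j - v - 1)\<close> of them share \<open>v\<close>, so one weight serves for
  every \<open>T v\<close>.\<close>

lemma sum_V_hit_le:
  assumes [measurable]: "A \<in> sets M" "B \<in> sets M"
  shows "(\<Sum>l | l \<in> {a..<a + p ^ j} \<and> \<not> int (p ^ j) dvd int l - int k.
      measure MM (V r \<times> Z \<inter> hit A k \<inter> hit B l)) \<le> real p ^ j * (1 - 1 / real p) * measure M A * measure M B"
proof -
  define S where "S = {l. l \<in> {a..<a + p ^ j} \<and> \<not> int (p ^ j) dvd int l - int k}"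
  define val where "val l = multiplicity (int p) (int l - int k)" for l
  define T where "T v = {z \<in> Z \<times> Z. fst z \<in> V (r + v) \<and> snd z \<in> A \<and> snd z +\<^sub>p fst z \<in> B}" for v
  define T' where "T' = {z \<in> Z \<times> Z. snd z \<in> A \<and> snd z +\<^sub>p fst z \<in> B}"
  have T [measurable]: "T v \<in> sets MM" for v
    unfolding T_def space_MM[symmetric] by measurable
  have T' [measurable]: "T' \<in> sets MM"
    unfolding T'_def space_MM[symmetric] by measurable
  have finS: "finite S" by (simp add: S_def)
  have S_val: "val l < j \<and> measure MM (V r \<times> Z \<inter> hit A k \<inter> hit B l) = real p ^ val l * measure MM (T (val l))"
    if l: "l \<in> S" for l
  proof
    have ne: "int l - int k \<noteq> 0" using l by (auto simp: S_def)
    have prime: "prime (int p)" using prime_p by simp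
    then have nu: "\<not> is_unit (int p)" by auto
    show "val l < j"
      using l ne nu power_dvd_iff_le_multiplicity[OF ne nu, of j] by (auto simp: val_def S_def)
    obtain m where m: "int l - int k = int p ^ val l * m" "\<not> int p dvd m"
      using multiplicity_decompose'[OF ne nu] by (auto simp: val_def)
    then have "coprime m (int p)"
      using prime prime_imp_coprime coprime_commute by blast
    from emeasure_pair_scale[OF assms this m(1), of r, folded T_def]
    have "emeasure MM {z \<in> Z \<times> Z. fst z \<in> V r \<and> snd z +\<^sub>p int k *\<^sub>p fst z \<in> A \<and>
        snd z +\<^sub>p int l *\<^sub>p fst z \<in> B} = ennreal (real p ^ val l) * emeasure MM (T (val l))" .
    also have "{z \<in> Z \<times> Z. fst z \<in> V r \<and> snd z +\<^sub>p int k *\<^sub>p fst z \<in> A \<and>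
        snd z +\<^sub>p int l *\<^sub>p fst z \<in> B} = V r \<times> Z \<inter> hit A k \<inter> hit B l"
      by (auto simp: hit_def padic_val_eq_def)
    finally have "emeasure MM (V r \<times> Z \<inter> hit A k \<inter> hit B l) =
      ennreal (real p ^ val l) * emeasure MM (T (val l))" .
    then show "measure MM (V r \<times> Z \<inter> hit A k \<inter> hit B l) = real p ^ val l * measure MM (T (val l))"
      by (simp add: measure_def enn2real_mult)
  qed
  have "(\<Sum>l\<in>S. measure MM (V r \<times> Z \<inter> hit A k \<inter> hit B l)) = (\<Sum>l\<in>S. real p ^ val l * measure MM (T (val l)))"
    using S_val by (intro sum.cong) auto
  also have "\<dots> = (\<Sum>v<j. \<Sum>l | l \<in> S \<and> val l = v. real p ^ val l * measure MM (T (val l)))"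
    by (rule sum.group[symmetric]) (use finS S_val in auto)
  also have "\<dots> = (\<Sum>v<j. real (card {l \<in> S. val l = v}) * real p ^ v * measure MM (T v))"
    by (intro sum.cong) auto
  also have "\<dots> \<le> (\<Sum>v<j. real p ^ j * (1 - 1 / real p) * measure MM (T v))"
  proof (intro sum_mono mult_right_mono)
    fix v assume "v \<in> {..<j}"
    \<comment> \<open>With \<open>j = v + Suc q\<close> the interval consists of whole periods of
      both \<open>p ^ v\<close> and \<open>p ^ Suc v\<close>, so the two counts are exactly
      \<open>p ^ Suc q\<close> and \<open>p ^ q\<close>.\<close>
    then obtain q where j: "j = v + Suc q" by (metis lessThan_iff less_imp_Suc_add add_Suc_right)
    let ?I = "\<lambda>d. {l \<in> {a..<a + p ^ j}. int d dvd int l - int k}"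
    have "{l \<in> S. val l = v} \<subseteq> ?I (p ^ v) - ?I (p ^ Suc v)"
    proof
      fix l assume l: "l \<in> {l \<in> S. val l = v}"
      then have ne: "int l - int k \<noteq> 0" by (auto simp: S_def)
      have nu: "\<not> is_unit (int p)" using p_gt_1 by simp
      show "l \<in> ?I (p ^ v) - ?I (p ^ Suc v)"
        using l power_dvd_iff_le_multiplicity[OF ne nu, of v] power_dvd_iff_le_multiplicity[OF ne nu, of "Suc v"]
        by (auto simp: S_def val_def simp del: power_Suc)
    qed
    then have "card {l \<in> S. val l = v} \<le> card (?I (p ^ v) - ?I (p ^ Suc v))"
      by (intro card_mono) auto
    also have "\<dots> = card (?I (p ^ v)) - card (?I (p ^ Suc v))"
      by (intro card_Diff_subset) (auto intro: dvd_mult_right)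
    also have "\<dots> = p ^ Suc q - p ^ q"
      using card_dvd_diff_interval[of "p ^ v" a "p ^ Suc q" "int k"]
        card_dvd_diff_interval[of "p ^ Suc v" a "p ^ q" "int k"] p_pos
      by (simp add: j power_add mult_ac)
    finally have "real (card {l \<in> S. val l = v}) \<le> real (p ^ Suc q - p ^ q)"
      by (rule of_nat_mono)
    also have "\<dots> = real p ^ Suc q - real p ^ q"
      using p_pos by (subst of_nat_diff) auto
    finally have "real (card {l \<in> S. val l = v}) * real p ^ v \<le> (real p ^ Suc q - real p ^ q) * real p ^ v"
      by (rule mult_right_mono) simp
    also have "\<dots> = real p ^ j * (1 - 1 / real p)"
      using p_pos by (simp add: j power_add field_simps)
    finally show "real (card {l \<in> S. val l = v}) * real p ^ v \<le> real p ^ j * (1 - 1 / real p)" .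
  qed auto
  also have "\<dots> = real p ^ j * (1 - 1 / real p) * (\<Sum>v<j. measure MM (T v))"
    by (simp add: sum_distrib_left)
  also have "\<dots> \<le> real p ^ j * (1 - 1 / real p) * (measure M A * measure M B)"
  proof (rule mult_left_mono)
    \<comment> \<open>The first component of a pair in \<open>T v\<close> has valuation
      \<open>r + v\<close>, so the \<open>T v\<close> are disjoint subsets of
      \<open>T'\<close>.\<close>
    have V_disj: "v = w" if "b \<in> V (r + v)" "b \<in> V (r + w)" for b v w
    proof (rule ccontr)
      assume "v \<noteq> w"
      then have "Suc (r + v) \<le> r + w \<or> Suc (r + w) \<le> r + v" by linarith
      then show False
        using that padic_eq_0_iff_dvd[of b p "Suc (r + v)" "r + w"]
          padic_eq_0_iff_dvd[of b p "Suc (r + w)" "r + v"] by (auto simp: padic_val_eq_def)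
    qed
    have "(\<Sum>v<j. measure MM (T v)) = measure MM (\<Union>v<j. T v)"
      by (rule Q.P.finite_measure_finite_Union[symmetric])
        (auto simp: disjoint_family_on_def T_def dest: V_disj, measurable)
    also have "\<dots> \<le> measure MM T'"
      by (intro Q.P.finite_measure_mono) (auto simp: T_def T'_def)
    also have "measure MM T' = measure M A * measure M B"
    proof -
      \<comment> \<open>Sections at fixed \<open>x\<close>: as \<open>b\<close> ranges over the
        whole group, \<open>x + b\<close> is Haar distributed, so \<open>x \<in> A\<close> and
        \<open>x + b \<in> B\<close> are independent.\<close>
      have "emeasure MM T' = (\<integral>\<^sup>+x. emeasure M ((\<lambda>b. (b, x)) -` T') \<partial>M)"
        by (rule Q.emeasure_pair_measure_alt2) simp
      also have "\<dots> = (\<integral>\<^sup>+x. emeasure M B * indicator A x \<partial>M)"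
      proof (rule nn_integral_cong)
        fix x assume "x \<in> space M"
        then have x: "x \<in> Z" by (simp add: space_M)
        then have "(\<lambda>b. (b, x)) -` T' = (if x \<in> A then {b \<in> Z. b +\<^sub>p x \<in> B} else {})"
          by (auto simp: T'_def Z.a_comm)
        then show "emeasure M ((\<lambda>b. (b, x)) -` T') = emeasure M B * indicator A x"
          using emeasure_translate[OF x] by simp
      qed
      also have "\<dots> = emeasure M B * emeasure M A"
        by (rule nn_integral_cmult_indicator) simp
      finally show ?thesis
        by (simp add: measure_def enn2real_mult mult.commute)
    qed
    finally show "(\<Sum>v<j. measure MM (T v)) \<le> measure M A * measure M B" .
  qed (use p_gt_1 in auto)
  finally show ?thesis by (simp add: S_def mult.assoc)
qed

section \<open>Conditioning on a fixed valuation and a coset\<close>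

text \<open>The same \<open>r\<close> governs the valuation of \<open>\<alpha>\<close> and the level
  of the coset, so that orbits starting in the coset remain in it.\<close>

definition sheet :: "nat \<Rightarrow> int \<Rightarrow> ((nat \<Rightarrow> int) \<times> (nat \<Rightarrow> int)) set" where
  "sheet r c = V r \<times> padic_cylinder p r c"

abbreviation "PP r c \<equiv> uniform_measure MM (sheet r c)"

lemma sheet_sets [measurable]: "sheet r c \<in> sets MM"
  unfolding sheet_def by measurable

lemma measure_sheet:
  assumes "c \<in> {0..<int p ^ r}"
  shows "measure MM (sheet r c) = (1 - 1 / real p) / real p ^ r / real p ^ r"
  using measure_V[of r] measure_cylinder[OF assms]
  by (simp add: sheet_def measure_def emeasure_pair_measure_Times enn2real_mult)

lemma measure_sheet_pos:
  assumes "c \<in> {0..<int p ^ r}"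
  shows "measure MM (sheet r c) > 0"
  using p_gt_1 by (simp add: measure_sheet[OF assms])

lemma prob_space_PP:
  assumes "c \<in> {0..<int p ^ r}"
  shows "prob_space (PP r c)"
  using measure_sheet_pos[OF assms]
  by (intro prob_space_uniform_measure) (auto simp: Q.P.emeasure_eq_measure)

text \<open>As \<open>p ^ r\<close> divides \<open>\<alpha>\<close>, all points of an orbit share
  the residue of \<open>x\<close> modulo \<open>p ^ r\<close>; a hit in \<open>A\<close> forces
  \<open>x\<close> into the coset. This transfers bounds on \<open>V r \<times> Z\<close> to the
  sheet.\<close>

lemma sheet_Int_hit:
  assumes "A \<subseteq> padic_cylinder p r c"
  shows "sheet r c \<inter> hit A k = V r \<times> Z \<inter> hit A k"
proof -
  have "x r = c" if "a \<in> V r" "x \<in> Z" "x +\<^sub>p int k *\<^sub>p a \<in> A" for a x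
  proof -
    have "(x +\<^sub>p int k *\<^sub>p a) r = c" using that assms by (auto simp: padic_cylinder_def)
    moreover have "(x +\<^sub>p int k *\<^sub>p a) r = x r"
      using that(1,2) by (simp add: padic_add padic_scale_def padic_val_eq_def padic_carrier)
    ultimately show ?thesis by simp
  qed
  then show ?thesis
    by (auto simp: sheet_def hit_def padic_cylinder_def)
qed

lemma measure_PP_hit:
  assumes [measurable]: "A \<in> sets M" and sub: "A \<subseteq> padic_cylinder p r c" and c: "c \<in> {0..<int p ^ r}"
  shows "measure (PP r c) (hit A k) = real p ^ r * measure M A"
proof -
  have "measure (PP r c) (hit A k) = measure MM (sheet r c \<inter> hit A k) / measure MM (sheet r c)"
    using measure_sheet_pos[OF c]
    by (intro measure_uniform_measure) (auto simp: Q.P.emeasure_eq_measure)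
  also have "\<dots> = real p ^ r * measure M A"
    using p_gt_1 by (simp add: sheet_Int_hit[OF sub] measure_V_hit measure_sheet[OF c] measure_V field_simps)
  finally show ?thesis .
qed

text \<open>Indices not congruent to \<open>k\<close> modulo \<open>p ^ j\<close> give the product
  term: the factor \<open>1 - 1 / p\<close> of \<open>sum_V_hit_le\<close> cancels against the
  measure of the sheet. Exactly one index is congruent to \<open>k\<close>, and it is bounded by the
  probability of a single hit.\<close>

lemma sum_PP_hit_le:
  assumes [measurable]: "A \<in> sets M" "B \<in> sets M"
    and sub: "A \<subseteq> padic_cylinder p r c" "B \<subseteq> padic_cylinder p r c" and c: "c \<in> {0..<int p ^ r}"
  shows "(\<Sum>l\<in>{a..<a + p ^ j}. measure (PP r c) (hit A k \<inter> hit B l)) \<le>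
    real p ^ j * (real p ^ r * measure M A) * (real p ^ r * measure M B) + real p ^ r * measure M B"
proof -
  interpret PP: prob_space "PP r c" by (rule prob_space_PP[OF c])
  let ?far = "{l. l \<in> {a..<a + p ^ j} \<and> \<not> int (p ^ j) dvd int l - int k}"
  let ?near = "{l \<in> {a..<a + p ^ j}. int (p ^ j) dvd int l - int k}"
  have eq: "measure (PP r c) (hit A k \<inter> hit B l) =
      measure MM (V r \<times> Z \<inter> hit A k \<inter> hit B l) / measure MM (sheet r c)" for l
  proof -
    have "measure (PP r c) (hit A k \<inter> hit B l) =
        measure MM (sheet r c \<inter> (hit A k \<inter> hit B l)) / measure MM (sheet r c)"
      using measure_sheet_pos[OF c]
      by (intro measure_uniform_measure) (auto simp: Q.P.emeasure_eq_measure)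
    also have "sheet r c \<inter> (hit A k \<inter> hit B l) = V r \<times> Z \<inter> hit A k \<inter> hit B l"
      using sheet_Int_hit[OF sub(1), of k] by auto
    finally show ?thesis .
  qed
  have "(\<Sum>l\<in>?far. measure (PP r c) (hit A k \<inter> hit B l)) =
      (\<Sum>l\<in>?far. measure MM (V r \<times> Z \<inter> hit A k \<inter> hit B l)) / measure MM (sheet r c)"
    unfolding eq sum_divide_distrib ..
  also have "\<dots> \<le> real p ^ j * (1 - 1 / real p) * measure M A * measure M B / measure MM (sheet r c)"
    by (intro divide_right_mono sum_V_hit_le) auto
  also have "\<dots> = real p ^ j * (real p ^ r * measure M A) * (real p ^ r * measure M B)"
    using p_gt_1 by (simp add: measure_sheet[OF c] field_simps)
  finally have far: "(\<Sum>l\<in>?far. measure (PP r c) (hit A k \<inter> hit B l)) \<le>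
    real p ^ j * (real p ^ r * measure M A) * (real p ^ r * measure M B)" .
  have "(\<Sum>l\<in>?near. measure (PP r c) (hit A k \<inter> hit B l)) \<le> (\<Sum>l\<in>?near. real p ^ r * measure M B)"
  proof (rule sum_mono)
    fix l
    have "hit B l \<in> sets (PP r c)" by simp
    then have "measure (PP r c) (hit A k \<inter> hit B l) \<le> measure (PP r c) (hit B l)"
      by (intro PP.finite_measure_mono) auto
    then show "measure (PP r c) (hit A k \<inter> hit B l) \<le> real p ^ r * measure M B"
      by (simp add: measure_PP_hit[OF _ sub(2) c])
  qed
  also have "\<dots> = real p ^ r * measure M B"
    using card_dvd_diff_interval[of "p ^ j" a 1 "int k"] p_pos by simp
  finally have near: "(\<Sum>l\<in>?near. measure (PP r c) (hit A k \<inter> hit B l)) \<le> real p ^ r * measure M B" .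
  have "(\<Sum>l\<in>{a..<a + p ^ j}. measure (PP r c) (hit A k \<inter> hit B l)) =
      (\<Sum>l\<in>?far. measure (PP r c) (hit A k \<inter> hit B l)) + (\<Sum>l\<in>?near. measure (PP r c) (hit A k \<inter> hit B l))"
    by (subst sum.union_disjoint[symmetric]) (auto intro!: sum.cong)
  with far near show ?thesis by simp
qed

section \<open>Hit counts in blocks of times\<close>

text \<open>A block is a full residue system modulo \<open>p ^ j\<close>, as
  \<open>sum_PP_hit_le\<close> requires; \<open>k < 2 * p ^ j\<close> on it explains the factor 2 in
  the levels \<open>2 * C * p ^ j\<close>.\<close>

definition block :: "nat \<Rightarrow> nat set" where
  "block j = {p ^ j..<p ^ j + p ^ j}"

lemma block_finite [simp]: "finite (block j)"
  by (simp add: block_def)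

lemma card_block: "card (block j) = p ^ j"
  by (simp add: block_def)

lemma sum_power_le: "(\<Sum>i\<le>j. real p ^ i) \<le> 2 * real p ^ j"
proof (induction j)
  case (Suc j)
  have "2 * real p ^ j \<le> real p * real p ^ j"
    using p_gt_1 by (intro mult_right_mono) auto
  with Suc show ?case by simp
qed simp

text \<open>The hit counts \<open>X j\<close> of the blocks satisfy the second-moment criterion with
  constant 4; their means are \<open>p ^ r\<close> times the terms of the divergent series.\<close>

lemma AE_hits_not_summable:
  fixes F :: "nat \<Rightarrow> (nat \<Rightarrow> int) set"
  assumes F [measurable]: "\<And>j. F j \<in> sets M"
    and sub: "\<And>j. F j \<subseteq> padic_cylinder p r c" and c: "c \<in> {0..<int p ^ r}"
    and div: "\<not> summable (\<lambda>j. real p ^ j * measure M (F j))"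
  shows "AE z in PP r c. \<not> summable (\<lambda>j. \<Sum>k\<in>block j. indicat_real (hit (F j) k) z)"
proof -
  interpret PP: prob_space "PP r c" by (rule prob_space_PP[OF c])
  define X where "X j z = (\<Sum>k\<in>block j. indicat_real (hit (F j) k) z)" for j z
  define q where "q j = real p ^ r * measure M (F j)" for j
  define \<mu> where "\<mu> j = real p ^ j * q j" for j
  have \<mu>0: "\<mu> j \<ge> 0" for j by (simp add: \<mu>_def q_def)
  have [measurable]: "hit (F j) k \<in> sets (PP r c)" for j k by simp
  have prod: "X i z * X j z = (\<Sum>k\<in>block i. \<Sum>l\<in>block j. indicat_real (hit (F i) k \<inter> hit (F j) l) z)" for i j z
    by (simp add: X_def sum_product indicator_inter_arith)
  have int: "integrable (PP r c) (indicat_real (hit (F i) k))" for i k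
    by (rule integrable_real_indicator) (simp_all add: PP.emeasure_eq_measure del: emeasure_uniform_measure)
  have int': "integrable (PP r c) (indicat_real (hit (F i) k \<inter> hit (F j) l))" for i j k l
    by (rule integrable_real_indicator) (simp_all add: PP.emeasure_eq_measure del: emeasure_uniform_measure)
  have int1: "integrable (PP r c) (X j)" for j
    unfolding X_def by (intro Bochner_Integration.integrable_sum int)
  have int2: "integrable (PP r c) (\<lambda>z. X i z * X j z)" for i j
    unfolding prod by (intro Bochner_Integration.integrable_sum int')
  have mean: "PP.expectation (X j) = \<mu> j" for j
  proof -
    have "PP.expectation (X j) = (\<Sum>k\<in>block j. measure (PP r c) (hit (F j) k))"
      unfolding X_def using int by (subst Bochner_Integration.integral_sum) auto
    also have "\<dots> = \<mu> j"
      by (simp add: measure_PP_hit[OF F sub c] card_block \<mu>_def q_def)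
    finally show ?thesis .
  qed
  have mixed: "PP.expectation (\<lambda>z. X i z * X j z) \<le> \<mu> i * \<mu> j + real p ^ i * q j" for i j
  proof -
    have "PP.expectation (\<lambda>z. X i z * X j z) =
        (\<Sum>k\<in>block i. \<Sum>l\<in>block j. measure (PP r c) (hit (F i) k \<inter> hit (F j) l))"
      unfolding prod using int'
      by (simp add: Bochner_Integration.integral_sum Bochner_Integration.integrable_sum)
    also have "\<dots> \<le> (\<Sum>k\<in>block i. real p ^ j * q i * q j + q j)"
      unfolding q_def block_def by (intro sum_mono sum_PP_hit_le F sub c)
    also have "\<dots> = \<mu> i * \<mu> j + real p ^ i * q j"
      by (simp add: card_block \<mu>_def algebra_simps)
    finally show ?thesis .
  qed
  \<comment> \<open>The error \<open>p ^ i * q j\<close> is controlled by the mean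
    \<open>\<mu> j = p ^ j * q j\<close> only for \<open>i \<le> j\<close>; for \<open>i > j\<close>
    the symmetry of \<open>X i * X j\<close> lets \<open>d j i\<close> serve instead.\<close>
  define d where "d i j = (if i \<le> j then real p ^ i * q j else 0)" for i j
  have d0: "d i j \<ge> 0" for i j by (simp add: d_def q_def)
  have mixed': "PP.expectation (\<lambda>z. X i z * X j z) \<le> \<mu> i * \<mu> j + (d i j + d j i)" for i j
    using mixed[of i j] mixed[of j i] d0[of i j] d0[of j i]
    by (cases "i \<le> j") (simp_all add: d_def mult.commute)
  have d_sum: "(\<Sum>i<n. d i j) \<le> 2 * \<mu> j" if "j < n" for j n
  proof -
    have "(\<Sum>i<n. d i j) = (\<Sum>i\<le>j. real p ^ i * q j)"
      unfolding d_def using that by (intro sum.mono_neutral_cong_right) auto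
    also have "\<dots> = (\<Sum>i\<le>j. real p ^ i) * q j"
      by (simp add: sum_distrib_right)
    also have "\<dots> \<le> 2 * real p ^ j * q j"
      by (intro mult_right_mono sum_power_le) (simp add: q_def)
    finally show ?thesis by (simp add: \<mu>_def)
  qed
  have second: "(\<Sum>i<n. \<Sum>j<n. PP.expectation (\<lambda>z. X i z * X j z))
      \<le> (\<Sum>i<n. \<mu> i)\<^sup>2 + 4 * (\<Sum>i<n. \<mu> i)" for n
  proof -
    \<comment> \<open>The double sums of \<open>d i j\<close> and of \<open>d j i\<close> each cost
      at most twice the sum of the means, which gives the constant 4.\<close>
    have "(\<Sum>i<n. \<Sum>j<n. PP.expectation (\<lambda>z. X i z * X j z)) \<le> (\<Sum>i<n. \<Sum>j<n. \<mu> i * \<mu> j + (d i j + d j i))"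
      by (intro sum_mono mixed')
    also have "\<dots> = (\<Sum>i<n. \<mu> i)\<^sup>2 + ((\<Sum>i<n. \<Sum>j<n. d i j) + (\<Sum>i<n. \<Sum>j<n. d j i))"
      by (simp add: sum.distrib power2_eq_square sum_product)
    also have "(\<Sum>i<n. \<Sum>j<n. d i j) = (\<Sum>j<n. \<Sum>i<n. d i j)"
      by (rule sum.swap)
    also have "(\<Sum>j<n. \<Sum>i<n. d i j) \<le> (\<Sum>j<n. 2 * \<mu> j)"
      by (intro sum_mono d_sum) simp
    also have "(\<Sum>i<n. 2 * \<mu> i) = 2 * (\<Sum>i<n. \<mu> i)"
      by (simp add: sum_distrib_left)
    finally show ?thesis by simp
  qed
  have "\<not> summable \<mu>"
  proof
    assume "summable \<mu>"
    then have "summable (\<lambda>j. (1 / real p ^ r) * \<mu> j)" by (rule summable_mult)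
    then show False using div p_pos by (simp add: \<mu>_def q_def)
  qed
  from PP.AE_not_summable_second_moment[OF int1 int2 _ mean second _ this]
  show ?thesis by (simp add: X_def sum_nonneg)
qed

section \<open>Integrability and growth along orbits\<close>

text \<open>Layer decomposition: on \<open>K\<close> the function is at most \<open>2 * C\<close>
  plus the sum of \<open>2 * C * p ^ Suc j\<close> over the levels \<open>j\<close> exceeded, and
  this majorant has finite integral.\<close>

lemma integrable_if_summable_levels:
  fixes g :: "(nat \<Rightarrow> int) \<Rightarrow> real"
  assumes [measurable]: "g \<in> borel_measurable M" "K \<in> sets M" and C: "C > 0"
    and summ: "summable (\<lambda>j. real p ^ j * measure M {x \<in> K. 2 * C * real p ^ j < \<bar>g x\<bar>})"
  shows "integrable M (\<lambda>x. indicator K x * g x)"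
proof (rule integrableI_bounded)
  define F where "F j = {x \<in> K. 2 * C * real p ^ j < \<bar>g x\<bar>}" for j
  have "F j = {x \<in> space M. x \<in> K \<and> 2 * C * real p ^ j < \<bar>g x\<bar>}" for j
    using sets.sets_into_space[OF assms(2)] by (auto simp: F_def)
  then have F [measurable]: "F j \<in> sets M" for j by simp
  let ?t = "\<lambda>j. 2 * C * real p ^ Suc j"
  have pw: "ennreal (norm (indicator K x * g x)) \<le> ennreal (2 * C) + (\<Sum>j. ennreal (?t j) * indicator (F j) x)" for x
  proof (cases "x \<in> K \<and> 2 * C < \<bar>g x\<bar>")
    case False
    then have "norm (indicator K x * g x) \<le> 2 * C" using C by (auto simp: indicator_def)
    then have "ennreal (norm (indicator K x * g x)) \<le> ennreal (2 * C) + 0"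
      by (simp only: add_0_right ennreal_leI)
    also have "\<dots> \<le> ennreal (2 * C) + (\<Sum>j. ennreal (?t j) * indicator (F j) x)"
      by (intro add_left_mono) simp
    finally show ?thesis .
  next
    case True
    obtain n where "\<bar>g x\<bar> / (2 * C) < real p ^ n"
      using real_arch_pow[of "real p"] p_gt_1 by auto
    then have ex: "\<exists>n. \<bar>g x\<bar> \<le> 2 * C * real p ^ n" using C by (intro exI[of _ n]) (simp add: field_simps)
    \<comment> \<open>The least such \<open>n\<close> is positive since
      \<open>\<bar>g x\<bar>\<close> exceeds \<open>2 * C\<close>. Its predecessor \<open>j\<close>
      is an exceeded level, and the single term \<open>2 * C * p ^ Suc j\<close> already
      dominates.\<close>
    define n where "n = (LEAST n. \<bar>g x\<bar> \<le> 2 * C * real p ^ n)"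
    have n: "\<bar>g x\<bar> \<le> 2 * C * real p ^ n" unfolding n_def by (rule LeastI_ex[OF ex])
    have "n \<noteq> 0" using n True by (intro notI) simp
    then obtain j where j: "n = Suc j" by (cases n) auto
    have "\<not> \<bar>g x\<bar> \<le> 2 * C * real p ^ j" using j not_less_Least[of j "\<lambda>n. \<bar>g x\<bar> \<le> 2 * C * real p ^ n"] by (simp add: n_def)
    then have "x \<in> F j" using True by (simp add: F_def)
    then have "ennreal (norm (indicator K x * g x)) \<le> ennreal (?t j) * indicator (F j) x"
      using n True by (simp add: j ennreal_leI)
    also have "\<dots> = (\<Sum>i\<in>{j}. ennreal (?t i) * indicator (F i) x)"
      by (simp only: sum.insert finite.emptyI sum.empty empty_iff add_0_right not_False_eq_True)
    also have "\<dots> \<le> (\<Sum>j. ennreal (?t j) * indicator (F j) x)"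
      by (rule sum_le_suminf) auto
    finally show ?thesis by (simp add: add_increasing)
  qed
  have "(\<integral>\<^sup>+x. ennreal (norm (indicator K x * g x)) \<partial>M)
      \<le> (\<integral>\<^sup>+x. ennreal (2 * C) + (\<Sum>j. ennreal (?t j) * indicator (F j) x) \<partial>M)"
    by (intro nn_integral_mono pw)
  also have "\<dots> = ennreal (2 * C) + (\<Sum>j. ennreal (?t j) * emeasure M (F j))"
    by (simp add: nn_integral_add nn_integral_suminf nn_integral_cmult_indicator emeasure_space_1)
  also have "(\<lambda>j. ennreal (?t j) * emeasure M (F j)) = (\<lambda>j. ennreal (?t j * measure M (F j)))"
    using C by (simp add: emeasure_eq_measure ennreal_mult)
  also have "ennreal (2 * C) + (\<Sum>j. ennreal (?t j * measure M (F j))) < \<infinity>"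
  proof -
    have "summable (\<lambda>j. (2 * C * real p) * (real p ^ j * measure M (F j)))"
      using summ by (intro summable_mult) (simp add: F_def)
    then have "summable (\<lambda>j. ?t j * measure M (F j))" by (simp add: mult_ac)
    then have "(\<Sum>j. ennreal (?t j * measure M (F j))) \<noteq> Orderings.top"
      using C by (intro ennreal_suminf_neq_top) auto
    then show ?thesis by (simp add: less_top)
  qed
  finally show "(\<integral>\<^sup>+x. ennreal (norm (indicator K x * g x)) \<partial>M) < \<infinity>" .
qed measurable

text \<open>An eventual bound \<open>C * k\<close> leaves all late blocks without hits, against the
  divergence of the hit counts. Fubini splits the almost sure statement on the sheet into one for
  almost all \<open>\<alpha>\<close> and then almost all \<open>x\<close>.\<close>

lemma AE_not_eventually_linear:
  fixes f :: "(nat \<Rightarrow> int) \<Rightarrow> real"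
  assumes [measurable]: "f \<in> borel_measurable M" and c: "c \<in> {0..<int p ^ r}" and C: "C > 0"
    and nint: "\<not> integrable M (\<lambda>x. indicator (padic_cylinder p r c) x * f x)"
  shows "AE a in M. a \<in> V r \<longrightarrow> (AE x in M. x \<in> padic_cylinder p r c \<longrightarrow>
    \<not> (\<forall>\<^sub>F k in sequentially. \<bar>f (x +\<^sub>p int k *\<^sub>p a)\<bar> \<le> C * real k))"
proof -
  define F where "F j = {x \<in> padic_cylinder p r c. 2 * C * real p ^ j < \<bar>f x\<bar>}" for j
  have "F j = {x \<in> space M. x \<in> padic_cylinder p r c \<and> 2 * C * real p ^ j < \<bar>f x\<bar>}" for j
    by (auto simp: F_def space_M padic_cylinder_def)
  then have F [measurable]: "F j \<in> sets M" for j by simp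
  have "\<not> summable (\<lambda>j. real p ^ j * measure M (F j))"
    using integrable_if_summable_levels[OF assms(1) cylinder_sets C] nint unfolding F_def by blast
  with F c have "AE z in PP r c. \<not> summable (\<lambda>j. \<Sum>k\<in>block j. indicat_real (hit (F j) k) z)"
    by (intro AE_hits_not_summable) (auto simp: F_def)
  then have "AE z in MM. z \<in> sheet r c \<longrightarrow> \<not> summable (\<lambda>j. \<Sum>k\<in>block j. indicat_real (hit (F j) k) z)"
    using measure_sheet_pos[OF c] by (subst (asm) AE_uniform_measure) (auto simp: Q.P.emeasure_eq_measure)
  then have "AE a in M. AE x in M. (a, x) \<in> sheet r c \<longrightarrow>
      \<not> summable (\<lambda>j. \<Sum>k\<in>block j. indicat_real (hit (F j) k) (a, x))"
    by (rule Q.AE_pair)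
  then show ?thesis
  proof (rule eventually_mono, intro impI, elim eventually_mono, intro impI notI)
    fix a x
    assume *: "(a, x) \<in> sheet r c \<longrightarrow> \<not> summable (\<lambda>j. \<Sum>k\<in>block j. indicat_real (hit (F j) k) (a, x))"
      and a: "a \<in> V r" and x: "x \<in> padic_cylinder p r c"
      and "\<forall>\<^sub>F k in sequentially. \<bar>f (x +\<^sub>p int k *\<^sub>p a)\<bar> \<le> C * real k"
    then obtain k0 where k0: "\<And>k. k \<ge> k0 \<Longrightarrow> \<bar>f (x +\<^sub>p int k *\<^sub>p a)\<bar> \<le> C * real k"
      by (auto simp: eventually_sequentially)
    have "(\<Sum>k\<in>block j. indicat_real (hit (F j) k) (a, x)) = 0" if j: "j \<notin> {..<k0}" for j
    proof (rule sum.neutral, intro ballI)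
      fix k assume k: "k \<in> block j"
      \<comment> \<open>This places the \<open>j\<close>-th block beyond \<open>k0\<close> once
        \<open>j \<ge> k0\<close>.\<close>
      have "j < p ^ j" using p_gt_1 by (intro less_exp[THEN order.strict_trans2] power_mono) auto
      then have "k \<ge> k0" using k j by (simp add: block_def)
      have "real k \<le> real (p ^ j + p ^ j)" using k by (intro of_nat_mono) (simp add: block_def)
      then have "C * real k \<le> C * (2 * real p ^ j)" using C by (intro mult_left_mono) auto
      with k0[OF \<open>k \<ge> k0\<close>] have "\<not> 2 * C * real p ^ j < \<bar>f (x +\<^sub>p int k *\<^sub>p a)\<bar>" by simp
      then show "indicat_real (hit (F j) k) (a, x) = 0" by (simp add: hit_def F_def)
    qed
    then have "summable (\<lambda>j. \<Sum>k\<in>block j. indicat_real (hit (F j) k) (a, x))"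
      by (intro summable_finite[of "{..<k0}"]) auto
    with * a x show False by (simp add: sheet_def)
  qed
qed

section \<open>Null sets and the set \<open>Gamma_b\<close>\<close>

lemma AE_translate:
  assumes "AE x in M. P x" and b: "b \<in> Z"
  shows "AE x in M. P (x +\<^sub>p b)"
proof -
  obtain N where N: "{x \<in> space M. \<not> P x} \<subseteq> N" "emeasure M N = 0" "N \<in> sets M"
    using AE_E[OF assms(1)] by blast
  have "b \<in> space M" using b by (simp add: space_M)
  then have [measurable]: "(\<lambda>x. b) \<in> M \<rightarrow>\<^sub>M M" by simp
  note [measurable] = N(3)
  have s: "{x \<in> Z. x +\<^sub>p b \<in> N} \<in> sets M" unfolding space_M[symmetric] by measurable
  have "emeasure M {x \<in> Z. x +\<^sub>p b \<in> N} = 0"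
    using emeasure_translate[OF b, of N] N by auto
  then show ?thesis
    using s N b by (intro AE_I[where N = "{x \<in> Z. x +\<^sub>p b \<in> N}"]) (auto simp: space_M subset_iff)
qed

text \<open>Only 0 has no finite valuation, and it lies in cylinders of measure
  \<open>1 / p ^ N\<close> for all \<open>N\<close>.\<close>

lemma AE_in_V: "AE a in M. \<exists>r. a \<in> V r"
proof -
  have z [measurable]: "{a \<in> space M. \<forall>N. a N = 0} \<in> sets M" by measurable
  have "measure M {a \<in> space M. \<forall>N. a N = 0} \<le> e" if e: "e > 0" for e
  proof -
    obtain N :: nat where N: "(1 / real p) ^ N < e"
      using real_arch_pow_inv[OF e, of "1 / real p"] p_gt_1 by force
    have "measure M {a \<in> space M. \<forall>N. a N = 0} \<le> measure M (padic_cylinder p N 0)"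
      by (intro finite_measure_mono) (auto simp: padic_cylinder_def space_M)
    also have "\<dots> = (1 / real p) ^ N"
      using measure_cylinder[of 0 N] p_pos by (simp add: power_one_over)
    finally show ?thesis using N by simp
  qed
  then have "measure M {a \<in> space M. \<forall>N. a N = 0} = 0"
    by (meson dense_ge measure_nonneg order_antisym)
  then have "AE a in M. \<not> (\<forall>N. a N = 0)"
    by (subst (asm) prob_eq_0) (auto elim!: eventually_mono)
  moreover have "AE a in M. a \<in> Z" by (rule AE_I2) (simp add: space_M)
  ultimately show ?thesis
  proof eventually_elim
    fix a assume nz: "\<not> (\<forall>N. a N = 0)" and a: "a \<in> Z"
    define L where "L = (LEAST N. a N \<noteq> 0)"
    have L: "a L \<noteq> 0" unfolding L_def using nz by (intro LeastI_ex[of "\<lambda>N. a N \<noteq> 0"]) blast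
    have "a 0 = 0" using padic_eq_0_iff_dvd[OF a, of 0 0] by simp
    with L obtain r where r: "L = Suc r" by (cases L) auto
    then have "a r = 0" using not_less_Least[of r "\<lambda>N. a N \<noteq> 0"] by (simp add: L_def)
    then show "\<exists>r. a \<in> V r" using L r a by (auto simp: padic_val_eq_def)
  qed
qed

text \<open>The finitely many cylinders of level \<open>r\<close> partition the group, so
  \<open>f\<close> is the finite sum of its restrictions.\<close>

lemma exists_cylinder_not_integrable:
  fixes f :: "(nat \<Rightarrow> int) \<Rightarrow> real"
  assumes "\<not> integrable M f"
  shows "\<exists>c\<in>{0..<int p ^ r}. \<not> integrable M (\<lambda>x. indicator (padic_cylinder p r c) x * f x)"
proof (rule ccontr)
  assume "\<not> ?thesis"
  then have "integrable M (\<lambda>x. \<Sum>c\<in>{0..<int p ^ r}. indicator (padic_cylinder p r c) x * f x)"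
    by (intro Bochner_Integration.integrable_sum) auto
  also have "?this \<longleftrightarrow> integrable M f"
  proof (rule Bochner_Integration.integrable_cong[OF refl])
    fix x assume "x \<in> space M"
    then have x: "x \<in> Z" "x r \<in> {0..<int p ^ r}" by (auto simp: space_M padic_carrier)
    have "(\<Sum>c\<in>{0..<int p ^ r}. indicator (padic_cylinder p r c) x * f x) =
        (\<Sum>c\<in>{0..<int p ^ r}. if c = x r then f x else 0)"
      using x by (intro sum.cong) (auto simp: padic_cylinder_def)
    also have "\<dots> = f x" using x(2) by simp
    finally show "(\<Sum>c\<in>{0..<int p ^ r}. indicator (padic_cylinder p r c) x * f x) = f x" .
  qed
  finally show False using assms by simp
qed

text \<open>A Borel version \<open>g\<close> of \<open>f\<close> is not integrable on some coset of
  each level. For almost every \<open>\<alpha>\<close>, with \<open>r\<close> its valuation, orbits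
  from almost all points of the coset of level \<open>r\<close> violate every linear bound;
  membership in \<open>Gamma_b\<close> would make this coset null.\<close>

lemma AE_notin_Gamma_b:
  assumes f: "f \<in> borel_measurable (completion M)" and nint: "\<not> integrable (completion M) f"
  shows "AE a in M. a \<notin> Gamma_b p (completion M) f"
proof -
  obtain g where g: "g \<in> borel_measurable M" "AE x in M. f x = g x"
    using completion_ex_borel_measurable_real[OF f] by auto
  have "\<not> integrable M g"
  proof
    assume "integrable M g"
    then have "integrable (completion M) g" using g(1) by (simp add: integrable_completion)
    moreover have "AE x in completion M. g x = f x"
      using AE_completion[OF g(2)] by eventually_elim simp
    ultimately show False
      using nint f by (metis integrable_cong_AE_imp)
  qed
  then obtain c where c: "\<And>r. c r \<in> {0..<int p ^ r}"
    "\<And>r. \<not> integrable M (\<lambda>x. indicator (padic_cylinder p r (c r)) x * g x)"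
    using exists_cylinder_not_integrable[of g] by metis
  \<comment> \<open>Only countably many \<open>r\<close> and slopes \<open>Suc n\<close> occur, so
    the exceptional null sets of \<open>\<alpha>\<close> can be united; the successor keeps the
    slope positive.\<close>
  have "AE a in M. \<forall>r n. a \<in> V r \<longrightarrow> (AE x in M. x \<in> padic_cylinder p r (c r) \<longrightarrow>
      \<not> (\<forall>\<^sub>F k in sequentially. \<bar>g (x +\<^sub>p int k *\<^sub>p a)\<bar> \<le> real (Suc n) * real k))"
    unfolding AE_all_countable by (intro allI AE_not_eventually_linear g(1) c) simp
  with AE_in_V show ?thesis
  proof eventually_elim
    fix a
    assume "\<exists>r. a \<in> V r" and *: "\<forall>r n. a \<in> V r \<longrightarrow> (AE x in M. x \<in> padic_cylinder p r (c r) \<longrightarrow>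
      \<not> (\<forall>\<^sub>F k in sequentially. \<bar>g (x +\<^sub>p int k *\<^sub>p a)\<bar> \<le> real (Suc n) * real k))"
    then obtain r where r: "a \<in> V r" by auto
    then have a: "a \<in> Z" by (simp add: padic_val_eq_def)
    show "a \<notin> Gamma_b p (completion M) f"
    proof
      assume "a \<in> Gamma_b p (completion M) f"
      then have lim: "AE x in M. limsup (\<lambda>k::nat. ereal (\<bar>f (x +\<^sub>p int k *\<^sub>p a)\<bar> / real k)) < \<infinity>"
        by (simp add: Gamma_b_def add_pow_eq_scale[OF a] AE_completion_iff)
      have "AE x in M. \<forall>n. x \<in> padic_cylinder p r (c r) \<longrightarrow>
          \<not> (\<forall>\<^sub>F k in sequentially. \<bar>g (x +\<^sub>p int k *\<^sub>p a)\<bar> \<le> real (Suc n) * real k)"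
        unfolding AE_all_countable using * r by blast
      \<comment> \<open>Translates of the null set where \<open>f\<close> and \<open>g\<close>
        differ are null, and there are countably many times \<open>k\<close>.\<close>
      moreover have "AE x in M. \<forall>k. f (x +\<^sub>p int k *\<^sub>p a) = g (x +\<^sub>p int k *\<^sub>p a)"
        unfolding AE_all_countable using AE_translate[OF g(2) scale_closed[OF a]] by blast
      ultimately have "AE x in M. x \<notin> padic_cylinder p r (c r)"
        using lim
      proof eventually_elim
        fix x
        assume 1: "\<forall>n. x \<in> padic_cylinder p r (c r) \<longrightarrow>
          \<not> (\<forall>\<^sub>F k in sequentially. \<bar>g (x +\<^sub>p int k *\<^sub>p a)\<bar> \<le> real (Suc n) * real k)"
          and 2: "\<forall>k. f (x +\<^sub>p int k *\<^sub>p a) = g (x +\<^sub>p int k *\<^sub>p a)"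
          and 3: "limsup (\<lambda>k::nat. ereal (\<bar>f (x +\<^sub>p int k *\<^sub>p a)\<bar> / real k)) < \<infinity>"
        obtain n where "limsup (\<lambda>k::nat. ereal (\<bar>f (x +\<^sub>p int k *\<^sub>p a)\<bar> / real k)) < ereal (real n)"
          using 3 less_PInf_Ex_of_nat by (metis less_irrefl)
        then have "\<forall>\<^sub>F k in sequentially. ereal (\<bar>f (x +\<^sub>p int k *\<^sub>p a)\<bar> / real k) < ereal (real n)"
          by (rule Limsup_lessD)
        \<comment> \<open>At \<open>k = 0\<close> the quotient is 0 by the convention for division
          and says nothing about the numerator, so only \<open>k > 0\<close> is used.\<close>
        with eventually_gt_at_top[of 0]
        have "\<forall>\<^sub>F k in sequentially. \<bar>g (x +\<^sub>p int k *\<^sub>p a)\<bar> \<le> real (Suc n) * real k"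
        proof eventually_elim
          fix k :: nat
          assume "0 < k" "ereal (\<bar>f (x +\<^sub>p int k *\<^sub>p a)\<bar> / real k) < ereal (real n)"
          then have "\<bar>g (x +\<^sub>p int k *\<^sub>p a)\<bar> < real n * real k" using 2 by (simp add: divide_less_eq)
          also have "\<dots> \<le> real (Suc n) * real k" by (intro mult_right_mono) auto
          finally show "\<bar>g (x +\<^sub>p int k *\<^sub>p a)\<bar> \<le> real (Suc n) * real k" by simp
        qed
        with 1 show "x \<notin> padic_cylinder p r (c r)" by blast
      qed
      then have "measure M (padic_cylinder p r (c r)) = 0"
        using AE_iff_null_sets[OF cylinder_sets, of r "c r"] by (auto simp: measure_def)
      then show False
        using measure_cylinder[OF c(1)] p_pos by simp
    qed
  qed
qed

end

theorem theorem7: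
  fixes p :: nat and M :: "(nat \<Rightarrow> int) measure" and f :: "(nat \<Rightarrow> int) \<Rightarrow> real"
  assumes "prime p"
    and "padic_haar_measure p M"
    and "f \<in> borel_measurable (completion M)"
    and "emeasure (completion M) (Gamma_b p (completion M) f) > 0"
  shows "integrable (completion M) f"
proof (rule ccontr)
  assume "\<not> integrable (completion M) f"
  interpret padic_haar p M
    using assms(1,2) by unfold_locales
  \<comment> \<open>A non-measurable set has \<open>emeasure\<close> 0 by convention, so the
    positivity hypothesis already yields measurability.\<close>
  have "Gamma_b p (completion M) f \<in> sets (completion M)"
    using assms(4) emeasure_notin_sets by fastforce
  moreover have "AE a in completion M. a \<notin> Gamma_b p (completion M) f"
    using AE_notin_Gamma_b[OF assms(3) \<open>\<not> integrable (completion M) f\<close>] by (rule AE_completion)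
  ultimately have "Gamma_b p (completion M) f \<in> null_sets (completion M)"
    by (simp add: AE_iff_null_sets)
  with assms(4) show False by auto
qed

end
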